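(* In the setting described in the context, suppose Method 1 does not stop, and let $(x^k)_{k\in\mathbb N}$ be the generated sequence. Then every weak accumulation point of $(x^k)_{k\in\mathbb N}$ belongs to $\operatorname{zer}(A+B)$.
   Context: Let $\mathcal H$ be a real Hilbert space with inner product $\langle\cdot,\cdot\rangle$ and norm $\|\cdot\|$. Let $A_1:\mathcal H\to\mathcal H$ be $\beta$-cocoercive for some $\beta>0$ (i.e. $\langle A_1x-A_1y,x-y\rangle\ge\beta\|A_1x-A_1y\|^2$ for all $x,y$), let $A_2:\mathcal H\to\mathcal H$ be maximally monotone and uniformly continuous, let $B:\mathcal H\rightrightarrows\mathcal H$ be maximally monotone, and set $A:=A_1+A_2$. Assume $\operatorname{zer}(A+B):=\{x:0\in Ax+Bx\}\neq\emptyset$. $J_{\alpha B}:=(I+\alpha B)^{-1}$ for $\alpha>0$, and $P_C$ denotes the orthogonal projection onto a nonempty closed convex set $C$. Fix $\theta,\delta\in(0,1)$, $\bar\delta>0$ with $1-\delta-\bar\delta>0$, and $\alpha_{-1}>0$ with $\alpha_{-1}\le4\beta\bar\delta$. Conceptual Algorithm: pick $x^0\in\mathcal H$. Given $x^k$ and $\alpha_{k-1}$, for $j\in\mathbb N$ let $\bar x^k_j:=J_{\alpha_{k-1}\theta^jB}(x^k-\alpha_{k-1}\theta^jAx^k)$ and let $j(k)$ be the smallest $j\in\mathbb N$ with $\alpha_{k-1}\theta^j\langle A_2x^k-A_2\bar x^k_j,x^k-\bar x^k_j\rangle\le\delta\|x^k-\bar x^k_j\|^2$. Set $\alpha_k:=\alpha_{k-1}\theta^{j(k)}$,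 $\bar x^k:=J_{\alpha_kB}(x^k-\alpha_kAx^k)$, $r_k:=\frac{\bar\delta}{\alpha_k}\|x^k-\bar x^k\|^2$ and $T_k:=\{x\in\mathcal H:\langle \frac{x^k-\bar x^k}{\alpha_k}-(A_2x^k-A_2\bar x^k),x-\bar x^k\rangle\le r_k\}$. Method 1 sets $x^{k+1}:=P_{T_k}(x^k)$ and stops if $x^{k+1}=x^k$. *)

theory Defs
  imports "HOL-Analysis.Analysis"
begin

definition monotone_op :: "('a::real_inner \<Rightarrow> 'a set) \<Rightarrow> bool" where
  "monotone_op B \<longleftrightarrow> (\<forall>x y u v. u \<in> B x \<longrightarrow> v \<in> B y \<longrightarrow> inner (u - v) (x - y) \<ge> 0)"

definition maximal_monotone :: "('a::real_inner \<Rightarrow> 'a set) \<Rightarrow> bool" where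
  "maximal_monotone B \<longleftrightarrow> monotone_op B \<and>
     (\<forall>x u. (\<forall>y v. v \<in> B y \<longrightarrow> inner (u - v) (x - y) \<ge> 0) \<longrightarrow> u \<in> B x)"

definition cocoercive :: "real \<Rightarrow> ('a::real_inner \<Rightarrow> 'a) \<Rightarrow> bool" where
  "cocoercive \<beta> T \<longleftrightarrow> (\<forall>x y. inner (T x - T y) (x - y) \<ge> \<beta> * (norm (T x - T y))\<^sup>2)"

definition resolvent :: "('a::real_inner \<Rightarrow> 'a set) \<Rightarrow> real \<Rightarrow> 'a \<Rightarrow> 'a" where
  "resolvent B \<alpha> z = (THE x. \<exists>u \<in> B x. z = x + \<alpha> *\<^sub>R u)"

definition proj :: "'a::real_inner set \<Rightarrow> 'a \<Rightarrow> 'a" where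
  "proj C z = (THE p. p \<in> C \<and> (\<forall>y\<in>C. norm (z - p) \<le> norm (z - y)))"

definition zer_sum :: "('a::real_inner \<Rightarrow> 'a) \<Rightarrow> ('a \<Rightarrow> 'a set) \<Rightarrow> 'a set" where
  "zer_sum A B = {x. 0 \<in> (\<lambda>b. A x + b) ` B x}"

definition weak_accumulation_point :: "(nat \<Rightarrow> 'a::real_inner) \<Rightarrow> 'a \<Rightarrow> bool" where
  "weak_accumulation_point x p \<longleftrightarrow>
     (\<exists>r. strict_mono r \<and> (\<forall>y. (\<lambda>n. inner (x (r n)) y) \<longlonglongrightarrow> inner p y))"

definition fb_point :: "('a::real_inner \<Rightarrow> 'a) \<Rightarrow> ('a \<Rightarrow> 'a set) \<Rightarrow> real \<Rightarrow> 'a \<Rightarrow> 'a" where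
  "fb_point A B \<alpha> xk = resolvent B \<alpha> (xk - \<alpha> *\<^sub>R A xk)"

definition linesearch_j :: "('a::real_inner \<Rightarrow> 'a) \<Rightarrow> ('a \<Rightarrow> 'a) \<Rightarrow> ('a \<Rightarrow> 'a set)
    \<Rightarrow> real \<Rightarrow> real \<Rightarrow> real \<Rightarrow> 'a \<Rightarrow> nat" where
  "linesearch_j A1 A2 B \<theta> \<delta> \<alpha>p xk = (LEAST j::nat.
     (let a = \<alpha>p * \<theta> ^ j; xb = fb_point (\<lambda>z. A1 z + A2 z) B a xk
      in a * inner (A2 xk - A2 xb) (xk - xb) \<le> \<delta> * (norm (xk - xb))\<^sup>2))"

definition T_set :: "('a::real_inner \<Rightarrow> 'a) \<Rightarrow> real \<Rightarrow> real \<Rightarrow> 'a \<Rightarrow> 'a \<Rightarrow> 'a set" where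
  "T_set A2 \<delta>bar \<alpha> xk xb =
     {z. inner ((1/\<alpha>) *\<^sub>R (xk - xb) - (A2 xk - A2 xb)) (z - xb) \<le> (\<delta>bar / \<alpha>) * (norm (xk - xb))\<^sup>2}"

end

theory Submission
  imports Defs
begin

text \<open>Let \<open>M = A + B\<close>, \<open>\<rho>\<^sub>k = norm (x\<^sub>k - xb\<^sub>k) / \<alpha>\<^sub>k\<close>, and let \<open>l\<^sub>k\<close> be the multiplier of the halfspace projection.
  Every \<open>w \<in> M y\<close> satisfies
  \<open>|x\<^sub>k\<^sub>+\<^sub>1 - y|\<^sup>2 \<le> |x\<^sub>k - y|\<^sup>2 - 2 l\<^sub>k \<langle>w, xb\<^sub>k - y\<rangle> - |x\<^sub>k\<^sub>+\<^sub>1 - x\<^sub>k|\<^sup>2\<close>; with \<open>w = 0\<close> this is Fejer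
  monotonicity, so the squared steps are summable. It suffices to find, for large \<open>k\<close>, a graph
  element \<open>w \<in> M y\<close> with \<open>w\<close> and \<open>x\<^sub>k - y\<close> small in norm, since the graph of \<open>M\<close> is weak-strong closed.
  If \<open>\<alpha>\<close> stays away from zero, \<open>y = xb\<^sub>k\<close> works.

  If \<open>\<alpha>\<close> tends to zero, a failed line search test only makes \<open>\<rho>\<^sub>k\<close> small at those (infinitely many)
  \<open>k\<close> where backtracking happens. For an arbitrary \<open>k\<close>, let \<open>m \<le> k\<close> minimise \<open>\<rho>\<close> over a tail segment
  ending in \<open>k\<close>, start at a graph element near \<open>x\<^sub>m\<close> of norm \<open>O(\<rho>\<^sub>m)\<close>, and follow the backward
  iteration \<open>y\<^sub>j = y\<^sub>j\<^sub>+\<^sub>1 + l\<^sub>j w\<^sub>j\<^sub>+\<^sub>1\<close>, along which \<open>|w\<^sub>j|\<close> does not increase. By the inequality above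
  \<open>|x\<^sub>j - y\<^sub>j|\<^sup>2\<close> grows per step by at most \<open>2 l\<^sub>j |w\<^sub>m| |x\<^sub>j - xb\<^sub>j| = O(l\<^sub>j \<alpha>\<^sub>j \<rho>\<^sub>j\<^sup>2)\<close>, which is
  controlled by the squared step \<open>|x\<^sub>j\<^sub>+\<^sub>1 - x\<^sub>j|\<^sup>2\<close> and hence has small sum.\<close>

subsection \<open>Surjectivity theorem of Minty\<close>

lemma maximal_monotoneD:
  assumes "maximal_monotone T" "u \<in> T x" "v \<in> T y"
  shows "inner (u - v) (x - y) \<ge> 0"
  using assms unfolding maximal_monotone_def monotone_op_def by blast

lemma maximal_monotoneI_mem:
  assumes "maximal_monotone T" "\<And>y v. v \<in> T y \<Longrightarrow> inner (u - v) (x - y) \<ge> 0"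
  shows "u \<in> T x"
  using assms unfolding maximal_monotone_def by blast

lemma nonneg_of_affine_nonneg:
  fixes q k :: real
  assumes "\<And>s. 0 < s \<Longrightarrow> s \<le> 1 \<Longrightarrow> 0 \<le> q + s * k"
  shows "0 \<le> q"
proof -
  have "((\<lambda>s. q + s * k) \<longlongrightarrow> q + 0 * k) (at_right 0)"
    by (intro tendsto_intros)
  moreover have "eventually (\<lambda>s. 0 \<le> q + s * k) (at_right 0)"
    using assms eventually_at_right_real[of 0 "1::real"] by (auto elim!: eventually_mono)
  ultimately show ?thesis
    using tendsto_lowerbound[of _ "q + 0 * k" "at_right (0::real)" 0] by simp
qed

lemma Cauchy_of_sq_le:
  fixes X :: "nat \<Rightarrow> 'a::real_normed_vector"
  assumes "\<And>m n. (norm (X m - X n))\<^sup>2 \<le> C * (1 / real (Suc m) + 1 / real (Suc n))" and "C > 0"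
  shows "Cauchy X"
proof (rule CauchyI)
  fix e :: real assume e: "0 < e"
  obtain N where N: "inverse (real (Suc N)) < e\<^sup>2 / (2 * C)"
    using reals_Archimedean[of "e\<^sup>2 / (2 * C)"] e \<open>C > 0\<close> by auto
  have "norm (X m - X n) < e" if "m \<ge> N" "n \<ge> N" for m n
  proof -
    have "1 / real (Suc m) \<le> inverse (real (Suc N))" "1 / real (Suc n) \<le> inverse (real (Suc N))"
      using that by (auto simp: field_simps)
    then have "1 / real (Suc m) + 1 / real (Suc n) < e\<^sup>2 / C"
      using N by simp
    then have "C * (1 / real (Suc m) + 1 / real (Suc n)) < C * (e\<^sup>2 / C)"
      using \<open>C > 0\<close> mult_strict_left_mono by blast
    then have "(norm (X m - X n))\<^sup>2 < e\<^sup>2"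
      using assms(1)[of m n] \<open>C > 0\<close> by simp
    then show ?thesis
      using e by (simp add: power2_less_imp_less)
  qed
  then show "\<exists>M. \<forall>m\<ge>M. \<forall>n\<ge>M. norm (X m - X n) < e" by blast
qed

text \<open>The minimiser over the epigraph of the Fitzpatrick function of \<open>T\<close>, perturbed by
  the squared norm, is of the form \<open>(x, -x)\<close> with \<open>-x \<in> T x\<close>.\<close>

lemma maximal_monotone_neg_fixpoint:
  fixes T :: "'a::{real_inner,complete_space} \<Rightarrow> 'a set"
  assumes T: "maximal_monotone T"
  shows "\<exists>x. - x \<in> T x"
proof -
  \<comment> \<open>\<open>P x u t\<close> says that \<open>(x, u, t)\<close> lies in the epigraph.
    The slack \<open>t\<close> avoids forming a supremum that may be infinite.\<close>
  define P where "P = (\<lambda>x u t. \<forall>y. \<forall>v\<in>T y. inner x v + inner y u - inner y v \<le> (t::real))"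
  define \<phi> where "\<phi> = (\<lambda>(x::'a) (u::'a) t. t + (norm x)\<^sup>2 / 2 + (norm u)\<^sup>2 / 2 :: real)"
  \<comment> \<open>If \<open>t < inner x u\<close>, the bounds in \<open>P\<close> make
    \<open>(x, u)\<close> monotonically related to the whole graph, so \<open>u \<in> T x\<close> by
    maximality. Testing \<open>P\<close> at this very point then contradicts the assumption.\<close>
  have lower: "inner x u \<le> t" if "P x u t" for x u t
  proof (rule ccontr)
    assume neg: "\<not> inner x u \<le> t"
    have "u \<in> T x"
    proof (rule maximal_monotoneI_mem[OF T])
      fix y v assume "v \<in> T y"
      then have "inner x v + inner y u - inner y v \<le> t" using that by (auto simp: P_def)
      then show "inner (u - v) (x - y) \<ge> 0"
        using neg by (simp add: inner_diff_left inner_diff_right inner_commute)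
    qed
    then show False using that neg by (fastforce simp: P_def)
  qed
  have phi_lower: "\<phi> x u t \<ge> (norm (x + u))\<^sup>2 / 2" if "P x u t" for x u t
    using lower[OF that] unfolding \<phi>_def dot_square_norm[symmetric]
    by (simp add: inner_add_left inner_add_right inner_commute field_simps)
  define V where "V = {\<phi> x u t |x u t. P x u t}"
  have graph: "P y v (inner y v)" if "v \<in> T y" for y v
    using maximal_monotoneD[OF T that]
    by (fastforce simp: P_def inner_diff_left inner_diff_right inner_commute algebra_simps)
  have "V \<noteq> {}"
  proof -
    obtain y v where "v \<in> T y"
      using maximal_monotoneI_mem[OF T, of 0 0] by blast
    then show ?thesis using graph unfolding V_def by blast
  qed
  have "0 \<le> \<phi> x u t" if "P x u t" for x u t
    using phi_lower[OF that] zero_le_power2[of "norm (x + u)"] by linarith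
  then have "bdd_below V"
    by (intro bdd_belowI[of _ 0]) (auto simp: V_def)
  define I where "I = Inf V"
  have I_le: "I \<le> \<phi> x u t" if "P x u t" for x u t
    unfolding I_def using that \<open>bdd_below V\<close> by (auto simp: V_def intro!: cInf_lower)
  have "\<exists>x u t. P x u t \<and> \<phi> x u t < I + 1 / real (Suc n)" for n
  proof -
    have "\<exists>s\<in>V. s < I + 1 / real (Suc n)"
      using cInf_lessD[OF \<open>V \<noteq> {}\<close>, of "I + 1 / real (Suc n)"] by (auto simp: I_def)
    then show ?thesis by (auto simp: V_def)
  qed
  then obtain X U W where XUW: "\<And>n. P (X n) (U n) (W n)"
    "\<And>n. \<phi> (X n) (U n) (W n) < I + 1 / real (Suc n)" by metis
  have conv: "P (x + s *\<^sub>R (x' - x)) (u + s *\<^sub>R (u' - u)) (t + s * (t' - t))"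
    if "P x u t" "P x' u' t'" "0 \<le> s" "s \<le> 1" for x u t x' u' t' s
    unfolding P_def
  proof (intro allI ballI)
    fix y v assume v: "v \<in> T y"
    define a where "a = inner x v + inner y u - inner y v"
    define b where "b = inner x' v + inner y u' - inner y v"
    have "(1 - s) * a + s * b \<le> (1 - s) * t + s * t'"
      using that v by (intro add_mono mult_left_mono) (auto simp: P_def a_def b_def)
    then show "inner (x + s *\<^sub>R (x' - x)) v + inner y (u + s *\<^sub>R (u' - u)) - inner y v \<le> t + s * (t' - t)"
      by (simp add: a_def b_def inner_add_left inner_add_right inner_diff_left inner_diff_right algebra_simps)
  qed
  \<comment> \<open>The midpoint of two epigraph points is in the epigraph, so \<open>I\<close>
    bounds its value from below. By the parallelogram identity that value is the mean of the two
    values minus 1/8 of the left-hand side, whence the factor 4.\<close>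
  have par: "(norm (X m - X n))\<^sup>2 + (norm (U m - U n))\<^sup>2 \<le> 4 * (1 / real (Suc m) + 1 / real (Suc n))" for m n
  proof -
    have mid: "(norm (x + (1/2) *\<^sub>R (x' - x)))\<^sup>2 = (norm x)\<^sup>2 / 2 + (norm x')\<^sup>2 / 2 - (norm (x - x'))\<^sup>2 / 4" for x x' :: 'a
      unfolding dot_square_norm[symmetric]
      by (simp add: inner_add_left inner_add_right inner_diff_left inner_diff_right inner_commute field_simps)
    have "I \<le> \<phi> (X m + (1/2) *\<^sub>R (X n - X m)) (U m + (1/2) *\<^sub>R (U n - U m)) (W m + 1/2 * (W n - W m))"
      by (intro I_le conv XUW) auto
    then show ?thesis
      using XUW(2)[of m] XUW(2)[of n] unfolding \<phi>_def mid by argo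
  qed
  have "Cauchy X"
    by (rule Cauchy_of_sq_le[where C = 4]) (simp_all only: add_increasing2 zero_less_numeral order_trans[OF _ par] zero_le_power2 order_refl)
  moreover have "Cauchy U"
    by (rule Cauchy_of_sq_le[where C = 4]) (simp_all only: add_increasing zero_less_numeral order_trans[OF _ par] zero_le_power2 order_refl)
  ultimately obtain x0 u0 where lim: "X \<longlonglongrightarrow> x0" "U \<longlonglongrightarrow> u0"
    using Cauchy_convergent convergent_def by metis
  have "(\<lambda>n. \<phi> (X n) (U n) (W n)) \<longlonglongrightarrow> I"
  proof (rule tendsto_sandwich[OF _ _ tendsto_const])
    show "(\<lambda>n. I + 1 / real (Suc n)) \<longlonglongrightarrow> I"
      using tendsto_add[OF tendsto_const[of I] LIMSEQ_Suc[OF lim_1_over_n]] by simp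
    show "eventually (\<lambda>n. \<phi> (X n) (U n) (W n) \<le> I + 1 / real (Suc n)) sequentially"
      using XUW(2) by (intro always_eventually allI less_imp_le)
  qed (use I_le XUW in auto)
  then have "(\<lambda>n. \<phi> (X n) (U n) (W n) - (norm (X n))\<^sup>2 / 2 - (norm (U n))\<^sup>2 / 2)
      \<longlonglongrightarrow> I - (norm x0)\<^sup>2 / 2 - (norm u0)\<^sup>2 / 2"
    by (intro tendsto_intros lim) auto
  then have limW: "W \<longlonglongrightarrow> I - (norm x0)\<^sup>2 / 2 - (norm u0)\<^sup>2 / 2"
    by (simp add: \<phi>_def)
  \<comment> \<open>This limit of \<open>W\<close> is the value that makes
    \<open>\<phi> x0 u0 t0\<close> equal to \<open>I\<close>.\<close>
  define t0 where "t0 = I - (norm x0)\<^sup>2 / 2 - (norm u0)\<^sup>2 / 2"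
  have P0: "P x0 u0 t0"
    unfolding P_def
  proof (intro allI ballI)
    fix y v assume v: "v \<in> T y"
    have "(\<lambda>n. inner (X n) v + inner y (U n) - inner y v) \<longlonglongrightarrow> inner x0 v + inner y u0 - inner y v"
      by (intro tendsto_intros lim)
    then show "inner x0 v + inner y u0 - inner y v \<le> t0"
      using limW XUW(1) v unfolding t0_def by (intro LIMSEQ_le) (auto simp: P_def)
  qed
  \<comment> \<open>One-sided derivative of \<open>\<phi>\<close> at the minimiser along the segment
    towards \<open>(x, u, t)\<close>: divide by \<open>s\<close> and let \<open>s\<close> tend to
    zero.\<close>
  have first_order: "0 \<le> t - t0 + inner x0 (x - x0) + inner u0 (u - u0)" if "P x u t" for x u t
  proof (rule nonneg_of_affine_nonneg)
    fix s :: real assume s: "0 < s" "s \<le> 1"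
    have sq: "(norm (x + s *\<^sub>R d))\<^sup>2 = (norm x)\<^sup>2 + 2 * s * inner x d + s\<^sup>2 * (norm d)\<^sup>2" for x d :: 'a
      unfolding dot_square_norm[symmetric]
      by (simp add: inner_add_left inner_add_right inner_commute power2_eq_square algebra_simps)
    have "I \<le> \<phi> (x0 + s *\<^sub>R (x - x0)) (u0 + s *\<^sub>R (u - u0)) (t0 + s * (t - t0))"
      using s by (intro I_le conv P0 that) auto
    then have "0 \<le> s * (t - t0 + inner x0 (x - x0) + inner u0 (u - u0)
        + s * ((norm (x - x0))\<^sup>2 / 2 + (norm (u - u0))\<^sup>2 / 2))"
      unfolding \<phi>_def sq by (simp add: t0_def power2_eq_square field_simps)
    then show "0 \<le> t - t0 + inner x0 (x - x0) + inner u0 (u - u0)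
        + s * ((norm (x - x0))\<^sup>2 / 2 + (norm (u - u0))\<^sup>2 / 2)"
      using s(1) by (simp add: zero_le_mult_iff)
  qed
  \<comment> \<open>Optimality at graph points combined with \<open>inner x0 u0 \<le> t0\<close>. It
    makes \<open>(- u0, - x0)\<close> monotonically related to the graph, hence a point of it;
    tested at that point it forces \<open>x0 + u0 = 0\<close>.\<close>
  have key: "(norm (x0 + u0))\<^sup>2 \<le> inner (- x0 - v) (- u0 - y)" if "v \<in> T y" for y v
    using first_order[OF graph[OF that]] lower[OF P0] unfolding dot_square_norm[symmetric]
    by (simp add: inner_add_left inner_add_right inner_diff_left inner_diff_right inner_commute)
  have mem: "- x0 \<in> T (- u0)"
    by (rule maximal_monotoneI_mem[OF T]) (use key order_trans zero_le_power2 in blast)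
  from key[OF mem] have "u0 = - x0"
    by (simp add: eq_neg_iff_add_eq_0 add.commute)
  then show ?thesis using mem by auto
qed

text \<open>Scaling by \<open>l\<close> and translating by \<open>z\<close> preserve maximal
  monotonicity, and \<open>- x \<in> S x\<close> for \<open>S = l T - z\<close> is exactly the
  resolvent equation.\<close>

theorem maximal_monotone_resolvent_exists:
  fixes T :: "'a::{real_inner,complete_space} \<Rightarrow> 'a set"
  assumes T: "maximal_monotone T" and l: "l > 0"
  shows "\<exists>x. \<exists>u\<in>T x. z = x + l *\<^sub>R u"
proof -
  define S where "S = (\<lambda>x. (\<lambda>u. l *\<^sub>R u - z) ` T x)"
  have "maximal_monotone S"
    unfolding maximal_monotone_def monotone_op_def
  proof (intro conjI allI impI)
    fix x y u v assume "u \<in> S x" "v \<in> S y"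
    then show "inner (u - v) (x - y) \<ge> 0"
      using maximal_monotoneD[OF T, of _ x _ y] l
      by (auto simp: S_def scaleR_diff_right[symmetric])
  next
    fix x u assume H: "\<forall>y v. v \<in> S y \<longrightarrow> inner (u - v) (x - y) \<ge> 0"
    have "(1 / l) *\<^sub>R (u + z) \<in> T x"
    proof (rule maximal_monotoneI_mem[OF T])
      fix y v assume "v \<in> T y"
      then have "inner (u - (l *\<^sub>R v - z)) (x - y) \<ge> 0" using H by (auto simp: S_def)
      moreover have "u - (l *\<^sub>R v - z) = l *\<^sub>R ((1 / l) *\<^sub>R (u + z) - v)"
        using l by (simp add: scaleR_diff_right)
      ultimately show "inner ((1 / l) *\<^sub>R (u + z) - v) (x - y) \<ge> 0"
        using l by (simp add: zero_le_mult_iff)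
    qed
    then show "u \<in> S x" using l by (auto simp: S_def intro!: image_eqI)
  qed
  from maximal_monotone_neg_fixpoint[OF this] obtain x u where "u \<in> T x" "- x = l *\<^sub>R u - z"
    by (auto simp: S_def)
  then show ?thesis by (metis diff_add_cancel diff_minus_eq_add uminus_add_conv_diff add_diff_cancel_left')
qed

subsection \<open>Forward-backward points, line search and projection\<close>

lemma maximal_monotone_closed_graph:
  assumes T: "maximal_monotone T" and mem: "\<And>n. u n \<in> T (x n)"
    and lim: "x \<longlonglongrightarrow> x0" "u \<longlonglongrightarrow> u0"
  shows "u0 \<in> T x0"
proof (rule maximal_monotoneI_mem[OF T])
  fix y v assume "v \<in> T y"
  then have "\<forall>n. 0 \<le> inner (u n - v) (x n - y)"
    using maximal_monotoneD[OF T mem] by blast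
  moreover have "(\<lambda>n. inner (u n - v) (x n - y)) \<longlonglongrightarrow> inner (u0 - v) (x0 - y)"
    by (intro tendsto_intros lim)
  ultimately show "inner (u0 - v) (x0 - y) \<ge> 0"
    by (intro LIMSEQ_le_const) auto
qed

text \<open>Cut the segment between the points into pieces shorter than the modulus \<open>d\<close>
  belonging to oscillation 1; the number of pieces bounds the increment. This growth bound stands in
  for a Lipschitz constant later on.\<close>

lemma uniformly_continuous_affine_growth:
  fixes f :: "'a::real_normed_vector \<Rightarrow> 'b::real_normed_vector"
  assumes "uniformly_continuous_on UNIV f"
  obtains L where "L > 0" "\<And>x y. norm (f x - f y) \<le> L * (1 + norm (x - y))"
proof -
  obtain d where d: "d > 0" "\<And>x y. norm (x - y) < d \<Longrightarrow> norm (f x - f y) < 1"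
    using assms[unfolded uniformly_continuous_on_def, rule_format, of 1]
    by (auto simp: dist_norm)
  have step: "norm (f x - f y) \<le> real (Suc n)" if "norm (x - y) < real (Suc n) * d" for n x y
    using that
  proof (induction n arbitrary: y)
    case 0
    then show ?case using d(2)[of x y] by simp
  next
    case (Suc n)
    define z where "z = y + (1 / real (Suc (Suc n))) *\<^sub>R (x - y)"
    have "norm (z - y) < d"
      using Suc.prems by (simp add: z_def divide_less_eq mult.commute)
    then have 1: "norm (f z - f y) < 1" by (rule d(2))
    have "x - z = (1 - 1 / real (Suc (Suc n))) *\<^sub>R (x - y)"
      by (simp add: z_def scaleR_diff_left)
    moreover have "1 - 1 / real (Suc (Suc n)) = real (Suc n) / real (Suc (Suc n))"
      by (simp add: field_simps)
    ultimately have "norm (x - z) = real (Suc n) / real (Suc (Suc n)) * norm (x - y)"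
      by simp
    also have "\<dots> < real (Suc n) / real (Suc (Suc n)) * (real (Suc (Suc n)) * d)"
      using Suc.prems by (intro mult_strict_left_mono) auto
    also have "\<dots> = real (Suc n) * d" by simp
    finally have "norm (f x - f z) \<le> real (Suc n)" by (rule Suc.IH)
    then show ?case
      using 1 norm_triangle_ineq[of "f x - f z" "f z - f y"] by simp
  qed
  have "norm (f x - f y) \<le> (1 + 1 / d) * (1 + norm (x - y))" for x y
  proof -
    define n where "n = nat \<lfloor>norm (x - y) / d\<rfloor>"
    have n: "real n \<le> norm (x - y) / d" "norm (x - y) / d < real (Suc n)"
      using d(1) unfolding n_def by (simp_all add: of_nat_nat) linarith+
    then have "norm (f x - f y) \<le> real (Suc n)"
      using d(1) by (intro step) (simp add: divide_less_eq)
    also have "\<dots> \<le> 1 + norm (x - y) / d" using n by simp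
    also have "\<dots> \<le> (1 + 1 / d) * (1 + norm (x - y))"
      using d(1) by (simp add: field_simps)
    finally show ?thesis .
  qed
  then show ?thesis using that[of "1 + 1 / d"] d(1) by (simp add: add_pos_pos)
qed

text \<open>A bootstrap in two rounds: for small \<open>a\<close> the affine growth of
  \<open>G\<close> first gives \<open>norm (x - y) < d\<close>, and then uniform continuity gives
  \<open>norm (G x - G y) < e / K\<close>, which is put back into the hypothesis. Thus the residual
  \<open>norm (x - y) / a\<close> is small although \<open>G\<close> need not be Lipschitz.\<close>

lemma small_residual:
  fixes G :: "'a::real_normed_vector \<Rightarrow> 'b::real_normed_vector"
  assumes G: "uniformly_continuous_on UNIV G" and K: "K > 0" and e: "e > 0"
  obtains h where "h > 0"
    "\<And>a x y. 0 < a \<Longrightarrow> a \<le> h \<Longrightarrow> norm (x - y) \<le> a * K * norm (G x - G y) \<Longrightarrow> norm (x - y) \<le> e * a"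
proof -
  obtain L where L: "L > 0" "\<And>x y. norm (G x - G y) \<le> L * (1 + norm (x - y))"
    using uniformly_continuous_affine_growth[OF G] by blast
  obtain d where d: "d > 0" "\<And>x y. norm (x - y) < d \<Longrightarrow> norm (G x - G y) < e / K"
    using G[unfolded uniformly_continuous_on_def, rule_format, of "e / K"] e K
    by (auto simp: dist_norm)
  \<comment> \<open>The first bound lets half of \<open>q\<close> absorb the linear term, the second
    makes the constant term at most \<open>d / 4\<close>; together they give
    \<open>q \<le> d / 2\<close>.\<close>
  define h where "h = min (1 / (2 * (K * L))) (d / (4 * (K * L)))"
  have KL: "K * L > 0" using K L by simp
  have "h > 0" using KL d by (simp add: h_def)
  moreover have "norm (x - y) \<le> e * a"
    if a: "0 < a" "a \<le> h" and le: "norm (x - y) \<le> a * K * norm (G x - G y)" for a x y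
  proof -
    define q where "q = norm (x - y)"
    have "a \<le> 1 / (2 * (K * L))" "a \<le> d / (4 * (K * L))" using a by (auto simp: h_def)
    then have "a * (2 * (K * L)) \<le> 1" "a * (4 * (K * L)) \<le> d"
      using KL by (simp_all only: pos_le_divide_eq mult_pos_pos zero_less_numeral)
    then have s: "a * (K * L) \<le> 1 / 2" "a * (K * L) \<le> d / 4" by argo+
    have "q \<le> a * K * (L * (1 + q))"
      using le L(2)[of x y] a K unfolding q_def by (meson mult_left_mono mult_nonneg_nonneg less_imp_le order_trans)
    also have "\<dots> = a * (K * L) + a * (K * L) * q" by (simp add: algebra_simps)
    also have "\<dots> \<le> d / 4 + 1 / 2 * q"
      using s by (intro add_mono mult_right_mono) (auto simp: q_def)
    finally have "q < d" using d(1) by linarith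
    then have "norm (G x - G y) < e / K" using d(2) by (simp add: q_def)
    then have "a * K * norm (G x - G y) \<le> a * K * (e / K)"
      using a K by (intro mult_left_mono) auto
    also have "\<dots> = e * a" using K by simp
    finally show ?thesis using le by linarith
  qed
  ultimately show ?thesis by (rule that)
qed

text \<open>The graph of \<open>B\<close> is closed in norm. With \<open>c = A x\<close>, the
  element \<open>g - c\<close> has the shape of the one attached to a forward-backward point of
  \<open>x\<close>, with scaled residual \<open>g\<close>.\<close>

lemma zero_of_small_residual:
  assumes B: "maximal_monotone B"
    and small: "\<And>e. 0 < e \<Longrightarrow> \<exists>y g. norm (x - y) \<le> e \<and> norm g \<le> e \<and> g - c \<in> B y"
  shows "- c \<in> B x"
proof -
  have "\<exists>y g. norm (x - y) \<le> 1 / real (Suc n) \<and> norm g \<le> 1 / real (Suc n) \<and> g - c \<in> B y" for n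
    by (rule small) simp
  then obtain y g where yg: "\<And>n. norm (x - y n) \<le> 1 / real (Suc n)"
    "\<And>n. norm (g n) \<le> 1 / real (Suc n)" "\<And>n. g n - c \<in> B (y n)"
    by metis
  have inv: "(\<lambda>n. 1 / real (Suc n)) \<longlonglongrightarrow> 0" by (rule LIMSEQ_Suc[OF lim_1_over_n])
  have "(\<lambda>n. x - y n) \<longlonglongrightarrow> 0"
    by (rule Lim_null_comparison[OF _ inv]) (use yg in auto)
  then have "(\<lambda>n. x - (x - y n)) \<longlonglongrightarrow> x - 0" by (intro tendsto_intros)
  moreover have "g \<longlonglongrightarrow> 0"
    by (rule Lim_null_comparison[OF _ inv]) (use yg in auto)
  then have "(\<lambda>n. g n - c) \<longlonglongrightarrow> 0 - c" by (intro tendsto_intros)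
  ultimately show ?thesis
    using maximal_monotone_closed_graph[OF B, of "\<lambda>n. g n - c" y] yg(3) by simp
qed

text \<open>Two solutions of the resolvent equation differ by \<open>- a (u - v)\<close>, while
  monotonicity makes the product of that difference with \<open>u - v\<close> nonnegative. This
  justifies the \<open>THE\<close> in \<open>resolvent\<close>.\<close>

lemma fb_point_unique:
  assumes B: "maximal_monotone B" and a: "a > 0" and y: "(1 / a) *\<^sub>R (x - y) - A x \<in> B y"
  shows "fb_point A B a x = y"
  unfolding fb_point_def resolvent_def
proof (rule the_equality)
  show "\<exists>u\<in>B y. x - a *\<^sub>R A x = y + a *\<^sub>R u"
    using a by (intro bexI[OF _ y]) (simp add: scaleR_diff_right)
next
  fix y' assume "\<exists>u\<in>B y'. x - a *\<^sub>R A x = y' + a *\<^sub>R u"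
  then obtain u where u: "u \<in> B y'" "x - a *\<^sub>R A x = y' + a *\<^sub>R u" by blast
  define v where "v = (1 / a) *\<^sub>R (x - y) - A x"
  have "x - a *\<^sub>R A x = y + a *\<^sub>R v" using a by (simp add: v_def scaleR_diff_right)
  then have eq: "y' - y = - (a *\<^sub>R (u - v))"
    using u(2) by (simp add: algebra_simps)
  have "0 \<le> inner (u - v) (y' - y)"
    using maximal_monotoneD[OF B u(1) y] by (simp add: v_def)
  also have "\<dots> = - a * (norm (u - v))\<^sup>2"
    unfolding eq by (simp add: power2_norm_eq_inner)
  finally have "norm (u - v) = 0" using a by (simp add: mult_le_0_iff)
  then show "y' = y" using eq by simp
qed

lemma fb_point_mem:
  fixes B :: "'a::{real_inner,complete_space} \<Rightarrow> 'a set"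
  assumes B: "maximal_monotone B" and a: "a > 0"
  shows "(1 / a) *\<^sub>R (x - fb_point A B a x) - A x \<in> B (fb_point A B a x)"
proof -
  obtain y u where u: "u \<in> B y" "x - a *\<^sub>R A x = y + a *\<^sub>R u"
    using maximal_monotone_resolvent_exists[OF B a] by blast
  have "x - y = a *\<^sub>R (u + A x)" using u(2) by (simp add: algebra_simps)
  then have "(1 / a) *\<^sub>R (x - y) - A x = u" using a by simp
  then have *: "(1 / a) *\<^sub>R (x - y) - A x \<in> B y" using u(1) by simp
  have "fb_point A B a x = y" by (rule fb_point_unique[where A = A, OF B a *])
  then show ?thesis using * by simp
qed

text \<open>Monotonicity of \<open>B\<close> between the two points and Cauchy-Schwarz give
  \<open>(norm p - norm p') * (norm p / a - norm p' / a') \<le> 0\<close>, but both factors are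
  positive if the smaller step moves farther. This carries an estimate at a rejected trial step over
  to the accepted, smaller one.\<close>

lemma fb_point_displacement_mono:
  fixes B :: "'a::{real_inner,complete_space} \<Rightarrow> 'a set"
  assumes B: "maximal_monotone B" and a: "0 < a" "a \<le> a'"
  shows "norm (x - fb_point A B a x) \<le> norm (x - fb_point A B a' x)"
proof (rule ccontr)
  define p where "p = x - fb_point A B a x"
  define p' where "p' = x - fb_point A B a' x"
  assume "\<not> ?thesis"
  then have lt: "norm p' < norm p" by (simp add: p_def p'_def)
  have a': "a' > 0" using a by simp
  have "0 \<le> inner ((1 / a) *\<^sub>R p - (1 / a') *\<^sub>R p') (p' - p)"
    using maximal_monotoneD[OF B fb_point_mem[OF B a(1)] fb_point_mem[OF B a'], of x A x A]
    by (simp add: p_def p'_def)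
  also have "\<dots> = (1 / a + 1 / a') * inner p p' - (norm p)\<^sup>2 / a - (norm p')\<^sup>2 / a'"
    unfolding power2_norm_eq_inner
    by (simp add: inner_diff_left inner_diff_right inner_commute algebra_simps)
  also have "\<dots> \<le> (1 / a + 1 / a') * (norm p * norm p') - (norm p)\<^sup>2 / a - (norm p')\<^sup>2 / a'"
    using a a' norm_cauchy_schwarz[of p p'] by (intro diff_right_mono mult_left_mono) auto
  also have "\<dots> = - ((norm p - norm p') * (norm p / a - norm p' / a'))"
    by (simp add: power2_eq_square algebra_simps add_divide_distrib diff_divide_distrib)
  finally have "(norm p - norm p') * (norm p / a - norm p' / a') \<le> 0" by simp
  moreover have "norm p' / a' < norm p / a"
    using lt a a' by (smt (verit) divide_strict_right_mono frac_le norm_ge_zero)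
  ultimately show False using lt by (simp add: mult_le_0_iff)
qed

text \<open>Given \<open>(p, u)\<close> monotonically related to the graph of the sum, take the
  forward-backward point \<open>y\<close> of \<open>A - u\<close> and \<open>B\<close> started at
  \<open>p\<close>. Relatedness bounds the scaled residual by \<open>norm (A p - A y)\<close>, so it
  is small for a small step, and closedness of the graph of \<open>B\<close> gives the inclusion at
  \<open>p\<close>.\<close>

lemma maximal_monotone_sum:
  fixes B :: "'a::{real_inner,complete_space} \<Rightarrow> 'a set"
  assumes B: "maximal_monotone B"
    and A: "\<And>x y. inner (A x - A y) (x - y) \<ge> 0"
    and uc: "uniformly_continuous_on UNIV A"
  shows "maximal_monotone (\<lambda>x. (\<lambda>b. A x + b) ` B x)"
  unfolding maximal_monotone_def monotone_op_def
proof (intro conjI allI impI)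
  fix x y u v assume "u \<in> (\<lambda>b. A x + b) ` B x" "v \<in> (\<lambda>b. A y + b) ` B y"
  then obtain b c where bc: "u = A x + b" "v = A y + c" "b \<in> B x" "c \<in> B y" by blast
  then have "inner (u - v) (x - y) = inner (A x - A y) (x - y) + inner (b - c) (x - y)"
    by (simp add: inner_add_left inner_diff_left)
  then show "inner (u - v) (x - y) \<ge> 0"
    using A[of x y] maximal_monotoneD[OF B bc(3,4)] by simp
next
  fix p u assume H: "\<forall>y v. v \<in> (\<lambda>b. A y + b) ` B y \<longrightarrow> inner (u - v) (p - y) \<ge> 0"
  have "- (A p - u) \<in> B p"
  proof (rule zero_of_small_residual[OF B])
    fix e :: real assume e: "e > 0"
    obtain h where h: "h > 0"
      "\<And>a x y. 0 < a \<Longrightarrow> a \<le> h \<Longrightarrow> norm (x - y) \<le> a * 1 * norm (A x - A y) \<Longrightarrow> norm (x - y) \<le> e * a"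
      using small_residual[OF uc zero_less_one e] by blast
    define a where "a = min h 1"
    have a: "0 < a" "a \<le> h" "a \<le> 1" using h(1) by (auto simp: a_def)
    define y where "y = fb_point (\<lambda>z. A z - u) B a p"
    define g where "g = (1 / a) *\<^sub>R (p - y)"
    have mem: "g - (A p - u) \<in> B y"
      using fb_point_mem[OF B a(1), of p "\<lambda>z. A z - u"] by (simp add: y_def g_def)
    have pg: "p - y = a *\<^sub>R g" using a by (simp add: g_def)
    have "0 \<le> inner (u - (A y + (g - (A p - u)))) (p - y)"
      using H mem by blast
    also have "u - (A y + (g - (A p - u))) = (A p - A y) - g" by simp
    finally have "inner g (p - y) \<le> inner (A p - A y) (p - y)" by (simp add: inner_diff_left)
    also have "\<dots> \<le> norm (A p - A y) * norm (p - y)" by (rule norm_cauchy_schwarz)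
    finally have "norm g * (a * norm g) \<le> norm (A p - A y) * (a * norm g)"
      using a by (simp add: pg dot_square_norm power2_eq_square mult.left_commute)
    then have "norm g \<le> norm (A p - A y)"
      using a by (cases "g = 0") auto
    then have "norm (p - y) \<le> a * 1 * norm (A p - A y)" using a by (simp add: pg)
    from h(2)[OF a(1,2) this] have "norm (p - y) \<le> e * a" .
    moreover have "e * a \<le> e" using a e by simp
    moreover have "norm g \<le> e" using \<open>norm (p - y) \<le> e * a\<close> a by (simp add: pg mult.commute)
    ultimately show "\<exists>y g. norm (p - y) \<le> e \<and> norm g \<le> e \<and> g - (A p - u) \<in> B y"
      using mem by (intro exI[of _ y] exI[of _ g]) auto
  qed
  then show "u \<in> (\<lambda>b. A p + b) ` B p" by (intro image_eqI) auto
qed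

text \<open>Cauchy-Schwarz brings a rejected trial into the form required by
  \<open>small_residual\<close>, with \<open>K = 1 / d\<close>.\<close>

lemma linesearch_failure_bound:
  fixes x y :: "'a::real_inner"
  assumes "\<not> a * inner (G x - G y) (x - y) \<le> d * (norm (x - y))\<^sup>2" and "a > 0" "d > 0"
  shows "norm (x - y) \<le> a * (1 / d) * norm (G x - G y)"
proof -
  have "d * (norm (x - y))\<^sup>2 \<le> a * (norm (G x - G y) * norm (x - y))"
    using assms norm_cauchy_schwarz[of "G x - G y" "x - y"] by (smt (verit) mult_left_mono)
  then have "norm (x - y) * (d * norm (x - y)) \<le> norm (x - y) * (a * norm (G x - G y))"
    by (simp add: power2_eq_square mult_ac)
  then have "x = y \<or> d * norm (x - y) \<le> a * norm (G x - G y)"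
    by (cases "x = y") (simp_all add: mult_le_cancel_left_pos)
  then show ?thesis using assms by (auto simp: field_simps)
qed

text \<open>If every trial failed, the residuals would become arbitrarily small as the steps shrink,
  so \<open>x\<close> itself would solve \<open>- A x \<in> B x\<close>. Then the forward-backward
  point is \<open>x\<close> and the trial \<open>j = 0\<close> reads \<open>0 \<le> 0\<close>, a
  contradiction.\<close>

lemma linesearch_terminates:
  fixes B :: "'a::{real_inner,complete_space} \<Rightarrow> 'a set"
  assumes B: "maximal_monotone B" and uc: "uniformly_continuous_on UNIV G"
    and pos: "0 < s" "0 < \<theta>" "\<theta> < 1" "0 < \<delta>"
  shows "\<exists>j::nat. s * \<theta> ^ j * inner (G x - G (fb_point A B (s * \<theta> ^ j) x)) (x - fb_point A B (s * \<theta> ^ j) x)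
           \<le> \<delta> * (norm (x - fb_point A B (s * \<theta> ^ j) x))\<^sup>2"
proof (rule ccontr)
  assume "\<not> ?thesis"
  then have fail: "\<not> s * \<theta> ^ j * inner (G x - G (fb_point A B (s * \<theta> ^ j) x)) (x - fb_point A B (s * \<theta> ^ j) x)
           \<le> \<delta> * (norm (x - fb_point A B (s * \<theta> ^ j) x))\<^sup>2" for j :: nat by blast
  have apos: "s * \<theta> ^ j > 0" for j using pos by simp
  have "- A x \<in> B x"
  proof (rule zero_of_small_residual[OF B])
    fix e :: real assume e: "e > 0"
    have d: "0 < 1 / \<delta>" using pos by simp
    obtain h where h: "h > 0"
      "\<And>a x y. 0 < a \<Longrightarrow> a \<le> h \<Longrightarrow> norm (x - y) \<le> a * (1 / \<delta>) * norm (G x - G y) \<Longrightarrow> norm (x - y) \<le> e * a"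
      using small_residual[OF uc d e] by blast
    have "(\<lambda>j. s * \<theta> ^ j) \<longlonglongrightarrow> s * 0"
      using pos by (intro tendsto_intros LIMSEQ_power_zero) auto
    then have "eventually (\<lambda>j. s * \<theta> ^ j < min h 1) sequentially"
      using h(1) by (intro order_tendstoD) auto
    then obtain j where j: "s * \<theta> ^ j < min h 1" using eventually_happens by fastforce
    define a where "a = s * \<theta> ^ j"
    have a: "0 < a" "a \<le> h" "a \<le> 1" using j apos by (auto simp: a_def)
    define y where "y = fb_point A B a x"
    have q: "norm (x - y) \<le> e * a"
      using linesearch_failure_bound[OF fail[of j] apos pos(4)] a unfolding a_def[symmetric] y_def[symmetric]
      by (intro h(2)) auto
    moreover have "e * a \<le> e" using a e by simp
    moreover have "norm ((1 / a) *\<^sub>R (x - y)) \<le> e" using q a by (simp add: divide_le_eq mult.commute)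
    moreover have "(1 / a) *\<^sub>R (x - y) - A x \<in> B y"
      unfolding y_def by (rule fb_point_mem[OF B a(1)])
    ultimately show "\<exists>y g. norm (x - y) \<le> e \<and> norm g \<le> e \<and> g - A x \<in> B y"
      by (intro exI[of _ y] exI[of _ "(1 / a) *\<^sub>R (x - y)"]) auto
  qed
  then have "fb_point A B (s * \<theta> ^ 0) x = x"
    by (intro fb_point_unique[OF B apos]) simp
  then show False using fail[of 0] by simp
qed

lemma proj_mem:
  assumes "x \<in> C"
  shows "proj C x = x"
  unfolding proj_def
proof (rule the_equality)
  fix p assume "p \<in> C \<and> (\<forall>y\<in>C. norm (x - p) \<le> norm (x - y))"
  then have "norm (x - p) \<le> norm (x - x)" using assms by blast
  then show "p = x" by simp
qed (use assms in simp)

lemma proj_halfspace: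
  fixes v x c :: "'a::real_inner"
  assumes out: "inner v (x - c) > r" and v: "v \<noteq> 0"
  shows "proj {z. inner v (z - c) \<le> r} x = x - ((inner v (x - c) - r) / (norm v)\<^sup>2) *\<^sub>R v"
proof -
  define l where "l = (inner v (x - c) - r) / (norm v)\<^sup>2"
  have l: "l > 0" "l * (norm v)\<^sup>2 = inner v (x - c) - r" using assms by (auto simp: l_def)
  \<comment> \<open>This estimate serves twice: nonnegativity of its left side shows that
    \<open>x - l v\<close> is nearest, and for any other nearest point it forces the left side to
    vanish.\<close>
  have uniq: "(norm (x - q - l *\<^sub>R v))\<^sup>2 \<le> (norm (x - q))\<^sup>2 - (norm (l *\<^sub>R v))\<^sup>2"
    if "inner v (q - c) \<le> r" for q
  proof -
    have "l * (norm v)\<^sup>2 \<le> inner v (x - q)"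
      using that unfolding l(2) by (simp add: inner_diff_right)
    then have "2 * l * (l * (norm v)\<^sup>2) \<le> 2 * l * inner v (x - q)"
      using l(1) by (intro mult_left_mono) auto
    moreover have "(norm (x - q - l *\<^sub>R v))\<^sup>2 = (norm (x - q))\<^sup>2 - 2 * l * inner v (x - q) + l * (l * (norm v)\<^sup>2)"
      unfolding power2_norm_eq_inner by (simp add: inner_diff_left inner_diff_right inner_commute algebra_simps)
    ultimately show ?thesis by (simp add: power2_eq_square mult_ac)
  qed
  show ?thesis
    unfolding proj_def l_def[symmetric]
  proof (rule the_equality)
    have "inner v (x - l *\<^sub>R v - c) = inner v (x - c) - l * (norm v)\<^sup>2"
      by (simp add: inner_diff_right power2_norm_eq_inner)
    then have mem: "x - l *\<^sub>R v \<in> {z. inner v (z - c) \<le> r}" using l(2) by simp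
    have "norm (x - (x - l *\<^sub>R v)) \<le> norm (x - q)" if "inner v (q - c) \<le> r" for q
    proof (rule power2_le_imp_le)
      show "(norm (x - (x - l *\<^sub>R v)))\<^sup>2 \<le> (norm (x - q))\<^sup>2"
        using uniq[OF that] zero_le_power2[of "norm (x - q - l *\<^sub>R v)"]
        unfolding diff_diff_eq2 add_diff_cancel_left' by linarith
    qed simp
    then show "x - l *\<^sub>R v \<in> {z. inner v (z - c) \<le> r} \<and>
        (\<forall>y\<in>{z. inner v (z - c) \<le> r}. norm (x - (x - l *\<^sub>R v)) \<le> norm (x - y))"
      using mem by blast
    fix q assume q: "q \<in> {z. inner v (z - c) \<le> r} \<and> (\<forall>y\<in>{z. inner v (z - c) \<le> r}. norm (x - q) \<le> norm (x - y))"
    then have "norm (x - q) \<le> norm (x - (x - l *\<^sub>R v))" using mem by blast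
    then have "norm (x - q) \<le> norm (l *\<^sub>R v)" by simp
    then have "(norm (x - q))\<^sup>2 \<le> (norm (l *\<^sub>R v))\<^sup>2" by (intro power_mono) auto
    moreover have "(norm (x - q - l *\<^sub>R v))\<^sup>2 \<le> (norm (x - q))\<^sup>2 - (norm (l *\<^sub>R v))\<^sup>2"
      using q uniq by blast
    ultimately have "(norm (x - q - l *\<^sub>R v))\<^sup>2 \<le> 0" by linarith
    then have "x - q - l *\<^sub>R v = 0" by simp
    then show "q = x - l *\<^sub>R v" by (simp add: algebra_simps)
  qed
qed

subsection \<open>Convergence\<close>

lemma cocoercive_norm_le:
  assumes "cocoercive \<beta> T" "\<beta> > 0"
  shows "norm (T x - T y) \<le> (1 / \<beta>) * norm (x - y)"
proof -
  have "\<beta> * (norm (T x - T y))\<^sup>2 \<le> norm (T x - T y) * norm (x - y)"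
    using assms norm_cauchy_schwarz[of "T x - T y" "x - y"]
    unfolding cocoercive_def by (meson order_trans)
  then have "norm (T x - T y) * (\<beta> * norm (T x - T y)) \<le> norm (T x - T y) * norm (x - y)"
    by (simp add: power2_eq_square mult_ac)
  then have "norm (T x - T y) = 0 \<or> \<beta> * norm (T x - T y) \<le> norm (x - y)"
    by (smt (verit) mult_le_cancel_left_pos norm_ge_zero)
  then show ?thesis using assms(2) by (auto simp: field_simps)
qed

lemma cocoercive_uniformly_continuous:
  assumes "cocoercive \<beta> T" "\<beta> > 0"
  shows "uniformly_continuous_on UNIV T"
proof (rule lipschitz_on_uniformly_continuous)
  show "(1 / \<beta>)-lipschitz_on UNIV T"
    using cocoercive_norm_le[OF assms] assms(2) by (intro lipschitz_onI) (auto simp: dist_norm)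
qed

text \<open>Monotonicity of \<open>B\<close> and \<open>A2\<close> leaves only the \<open>A1\<close>
  term, whose loss against \<open>xb\<close> is paid by cocoercivity. For
  \<open>A1 y + A2 y + c = 0\<close> the estimate says that the zero \<open>y\<close> lies in
  \<open>T_set\<close>; general graph elements are needed for the backward iteration.\<close>

lemma halfspace_separates_graph:
  assumes A1: "cocoercive \<beta> A1" and A2: "\<And>x y. inner (A2 x - A2 y) (x - y) \<ge> 0"
    and B: "maximal_monotone B" and pos: "\<beta> > 0" "a > 0" "a \<le> 4 * \<beta> * \<delta>bar"
    and mem: "(1 / a) *\<^sub>R (x - xb) - (A1 x + A2 x) \<in> B xb" and c: "c \<in> B y"
  shows "inner (A1 y + A2 y + c) (xb - y) - (\<delta>bar / a) * (norm (x - xb))\<^sup>2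
      \<le> inner ((1 / a) *\<^sub>R (x - xb) - (A2 x - A2 xb)) (xb - y)"
proof -
  define v where "v = (1 / a) *\<^sub>R (x - xb) - (A2 x - A2 xb)"
  define D where "D = A1 x - A1 y"
  define q where "q = norm (x - xb)"
  have "0 \<le> inner ((1 / a) *\<^sub>R (x - xb) - (A1 x + A2 x) - c) (xb - y)"
    by (rule maximal_monotoneD[OF B mem c])
  also have "(1 / a) *\<^sub>R (x - xb) - (A1 x + A2 x) - c = v - (A1 y + A2 y + c) - D - (A2 xb - A2 y)"
    by (simp add: v_def D_def)
  also have "inner \<dots> (xb - y) = inner v (xb - y) - inner (A1 y + A2 y + c) (xb - y)
      - inner D (xb - y) - inner (A2 xb - A2 y) (xb - y)"
    by (simp only: inner_diff_left)
  finally have 1: "inner (A1 y + A2 y + c) (xb - y) + inner D (xb - y) \<le> inner v (xb - y)"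
    using A2[of xb y] by linarith
  have "inner D (xb - y) = inner D (x - y) - inner D (x - xb)" by (simp add: inner_diff_right)
  moreover have "inner D (x - y) \<ge> \<beta> * (norm D)\<^sup>2" using A1 by (simp add: cocoercive_def D_def)
  moreover have "inner D (x - xb) \<le> norm D * q" unfolding q_def by (rule norm_cauchy_schwarz)
  \<comment> \<open>Completing the square in \<open>norm D\<close> leaves the loss
    \<open>q\<^sup>2 / (4 * \<beta>)\<close>, which the bound
    \<open>a \<le> 4 * \<beta> * \<delta>bar\<close> turns into the slack of the halfspace.\<close>
  moreover have "\<beta> * (norm D)\<^sup>2 - norm D * q + q\<^sup>2 / (4 * \<beta>) = \<beta> * (norm D - q / (2 * \<beta>))\<^sup>2"
    using pos by (simp add: power2_eq_square field_simps)
  moreover have "\<beta> * (norm D - q / (2 * \<beta>))\<^sup>2 \<ge> 0" using pos by simp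
  ultimately have "inner D (xb - y) \<ge> - (q\<^sup>2 / (4 * \<beta>))" by linarith
  moreover have "q\<^sup>2 / (4 * \<beta>) \<le> (\<delta>bar / a) * q\<^sup>2"
  proof -
    have "1 / (4 * \<beta>) \<le> \<delta>bar / a" using pos by (simp add: field_simps)
    from mult_right_mono[OF this, of "q\<^sup>2"] show ?thesis by simp
  qed
  ultimately show ?thesis using 1 unfolding v_def q_def by linarith
qed

text \<open>By the line search test, \<open>x\<close> violates the halfspace by at least
  \<open>c q\<^sup>2 / a\<close>, so the projection has an explicit multiplier \<open>l\<close>. The
  first estimate charges residuals to squared steps, the second is a Fejer inequality relative to
  any graph element, and the third bounds \<open>norm (x - xb)\<close> by the step.\<close>

lemma projection_step:
  fixes x xb :: "'a::real_inner"
  assumes A1: "cocoercive \<beta> A1" and A2: "\<And>x y. inner (A2 x - A2 y) (x - y) \<ge> 0"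
    and B: "maximal_monotone B" and pos: "\<beta> > 0" "a > 0" "a \<le> 4 * \<beta> * \<delta>bar"
    and mem: "(1 / a) *\<^sub>R (x - xb) - (A1 x + A2 x) \<in> B xb"
    and test: "a * inner (A2 x - A2 xb) (x - xb) \<le> \<delta> * (norm (x - xb))\<^sup>2"
    and c: "c = 1 - \<delta> - \<delta>bar" "c > 0"
    and neq: "x \<noteq> xb"
    and x': "x' = proj (T_set A2 \<delta>bar a x xb) x"
  obtains l where "l > 0"
    "c * l * (norm (x - xb))\<^sup>2 / a \<le> (norm (x' - x))\<^sup>2"
    "\<And>y w. w \<in> (\<lambda>b. A1 y + A2 y + b) ` B y \<Longrightarrow>
       (norm (x' - y))\<^sup>2 \<le> (norm (x - y))\<^sup>2 - 2 * l * inner w (xb - y) - (norm (x' - x))\<^sup>2"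
    "c * (norm (x - xb))\<^sup>2 \<le> norm (x' - x) * (norm (x - xb) + a * norm (A2 x - A2 xb))"
proof -
  define v where "v = (1 / a) *\<^sub>R (x - xb) - (A2 x - A2 xb)"
  define q where "q = norm (x - xb)"
  define r where "r = (\<delta>bar / a) * q\<^sup>2"
  have q: "q > 0" using neq by (simp add: q_def)
  have "inner v (x - xb) = q\<^sup>2 / a - inner (A2 x - A2 xb) (x - xb)"
    by (simp add: v_def q_def inner_diff_left power2_norm_eq_inner)
  moreover have "inner (A2 x - A2 xb) (x - xb) \<le> \<delta> * q\<^sup>2 / a"
    using test pos by (simp add: q_def field_simps)
  ultimately have excess: "c * q\<^sup>2 / a \<le> inner v (x - xb) - r"
    by (simp add: r_def c left_diff_distrib diff_divide_distrib)
  have epos: "0 < c * q\<^sup>2 / a" using c q pos by simp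
  then have out: "inner v (x - xb) > r" using excess by linarith
  have r0: "r \<ge> 0"
  proof -
    have "0 < 4 * \<beta> * \<delta>bar" using pos by linarith
    then have "0 < \<delta>bar" using pos by (simp add: zero_less_mult_iff)
    then show ?thesis using pos by (simp add: r_def)
  qed
  then have v0: "v \<noteq> 0" using out by auto
  define l where "l = (inner v (x - xb) - r) / (norm v)\<^sup>2"
  have l: "l > 0" "l * (norm v)\<^sup>2 = inner v (x - xb) - r" using out v0 by (auto simp: l_def)
  have "T_set A2 \<delta>bar a x xb = {z. inner v (z - xb) \<le> r}"
    by (simp add: T_set_def v_def r_def q_def)
  then have x'_eq: "x' = x - l *\<^sub>R v"
    using proj_halfspace[OF out v0] x' by (simp add: l_def)
  have step: "norm (x' - x) = l * norm v" using l by (simp add: x'_eq)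
  have lv: "c * q\<^sup>2 / a \<le> l * (norm v)\<^sup>2" using l excess by simp
  have 1: "c * l * (norm (x - xb))\<^sup>2 / a \<le> (norm (x' - x))\<^sup>2"
    using mult_left_mono[OF lv, of l] l(1)
    by (simp add: step q_def power2_eq_square mult_ac)
  have 2: "(norm (x' - y))\<^sup>2 \<le> (norm (x - y))\<^sup>2 - 2 * l * inner w (xb - y) - (norm (x' - x))\<^sup>2"
    if "w \<in> (\<lambda>b. A1 y + A2 y + b) ` B y" for y w
  proof -
    have "inner w (xb - y) - r \<le> inner v (xb - y)"
      using that halfspace_separates_graph[OF A1 A2 B pos mem] by (auto simp: v_def r_def q_def)
    then have "l * (norm v)\<^sup>2 + inner w (xb - y) \<le> inner v (x - y)"
      unfolding l(2) by (simp add: inner_diff_right)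
    then have "2 * l * (l * (norm v)\<^sup>2 + inner w (xb - y)) \<le> 2 * l * inner v (x - y)"
      using l(1) by (intro mult_left_mono) auto
    moreover have "(norm (x' - y))\<^sup>2 = (norm (x - y))\<^sup>2 - 2 * l * inner v (x - y) + l\<^sup>2 * (norm v)\<^sup>2"
      unfolding x'_eq power2_norm_eq_inner
      by (simp add: inner_diff_left inner_diff_right inner_commute power2_eq_square algebra_simps)
    ultimately show ?thesis
      by (simp add: step power2_eq_square algebra_simps)
  qed
  have "a *\<^sub>R v = (x - xb) - a *\<^sub>R (A2 x - A2 xb)"
    using pos by (simp add: v_def scaleR_diff_right)
  then have "norm (a *\<^sub>R v) \<le> norm (x - xb) + norm (a *\<^sub>R (A2 x - A2 xb))"
    by (metis norm_triangle_ineq4)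
  then have av: "a * norm v \<le> q + a * norm (A2 x - A2 xb)" using pos by (simp add: q_def)
  have "c * q\<^sup>2 \<le> l * norm v * (a * norm v)"
    using lv pos by (simp add: field_simps power2_eq_square)
  also have "\<dots> \<le> l * norm v * (q + a * norm (A2 x - A2 xb))"
    using av l by (intro mult_left_mono) auto
  finally have 3: "c * (norm (x - xb))\<^sup>2 \<le> norm (x' - x) * (norm (x - xb) + a * norm (A2 x - A2 xb))"
    by (simp add: step q_def)
  show ?thesis by (rule that[OF l(1) 1 2 3])
qed

text \<open>\<open>y'\<close> is the proximal point of \<open>y\<close>; monotonicity between
  \<open>(y, w)\<close> and \<open>(y', w')\<close> gives
  \<open>inner w' w' \<le> inner w w'\<close>, so the norm cannot grow.\<close>

lemma backward_step:
  fixes T :: "'a::{real_inner,complete_space} \<Rightarrow> 'a set"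
  assumes T: "maximal_monotone T" and l: "l > 0" and w: "w \<in> T y"
  obtains y' w' where "w' \<in> T y'" "y = y' + l *\<^sub>R w'" "norm w' \<le> norm w"
proof -
  obtain y' w' where yw: "w' \<in> T y'" "y = y' + l *\<^sub>R w'"
    using maximal_monotone_resolvent_exists[OF T l] by blast
  have "0 \<le> inner (w - w') (y - y')" by (rule maximal_monotoneD[OF T w yw(1)])
  then have "0 \<le> l * inner (w - w') w'" using yw(2) by simp
  then have "inner w' w' \<le> inner w w'" using l by (simp add: zero_le_mult_iff inner_diff_left)
  also have "\<dots> \<le> norm w * norm w'" by (rule norm_cauchy_schwarz)
  finally have "norm w' * norm w' \<le> norm w * norm w'" by (simp add: dot_square_norm power2_eq_square)
  then have "norm w' \<le> norm w" by (cases "w' = 0") auto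
  then show ?thesis using that yw by blast
qed

text \<open>The graph element at \<open>xb\<close> itself has norm up to \<open>\<rho> + norm (A x - A xb)\<close>, which need not be
  of order \<open>\<rho>\<close> because \<open>A\<close> is not Lipschitz. A backward step from \<open>x\<close> of length \<open>a / \<rho>\<close> reaches
  a graph element of norm \<open>O(\<rho>)\<close> at distance \<open>O(a)\<close>.\<close>

lemma nearby_small_graph_element:
  fixes B :: "'a::{real_inner,complete_space} \<Rightarrow> 'a set"
  assumes B: "maximal_monotone B" and A: "\<And>x y. inner (A x - A y) (x - y) \<ge> 0"
    and M: "maximal_monotone (\<lambda>x. (\<lambda>b. A x + b) ` B x)"
    and L: "L > 0" "\<And>x y. norm (A x - A y) \<le> L * (1 + norm (x - y))"
    and a: "0 < a" "a \<le> a1"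
    and mem: "(1 / a) *\<^sub>R (x - xb) - A x \<in> B xb"
    and rho: "\<rho> = norm (x - xb) / a" "0 < \<rho>" "\<rho> \<le> 1"
    and C: "C = 3 + a1 * L + L"
  obtains y w where "w \<in> (\<lambda>b. A y + b) ` B y" "norm w \<le> C * \<rho>" "norm (x - y) \<le> C * a"
proof -
  define g where "g = (1 / a) *\<^sub>R (x - xb)"
  have g: "norm g = \<rho>" "x - xb = a *\<^sub>R g" using a rho by (auto simp: g_def)
  have mu: "a / \<rho> > 0" using a(1) rho(2) by (rule divide_pos_pos)
  obtain y w where yw: "w \<in> (\<lambda>b. A y + b) ` B y" "x = y + (a / \<rho>) *\<^sub>R w"
    using maximal_monotone_resolvent_exists[OF M mu] by blast
  then obtain b where b: "w = A y + b" "b \<in> B y" by blast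
  \<comment> \<open>Both claims reduce to \<open>s \<le> C\<close>, because
    \<open>norm w = s * \<rho>\<close> and \<open>norm (x - y) = a * s\<close>.\<close>
  define s where "s = norm w / \<rho>"
  have s: "s \<ge> 0" "norm w = s * \<rho>" using rho(2,3) by (auto simp: s_def)
  have xy: "x - y = (a / \<rho>) *\<^sub>R w" using yw(2) by simp
  have nxy: "norm (x - y) = a * s" using a rho(2,3) by (simp add: xy s_def)
  have "0 \<le> inner ((g - A x) - b) (xb - y)"
    using maximal_monotoneD[OF B mem b(2)] by (simp add: g_def)
  also have "(g - A x) - b = (g - w) - (A x - A y)" by (simp add: b)
  also have "xb - y = (x - y) - a *\<^sub>R g" using g(2) by (simp add: algebra_simps)
  also have "inner ((g - w) - (A x - A y)) ((x - y) - a *\<^sub>R g)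
     = inner g (x - y) - inner w (x - y) - inner (A x - A y) (x - y)
       - a * inner g g + a * inner w g + a * inner (A x - A y) g"
    by (simp add: inner_diff_left inner_diff_right algebra_simps)
  finally have "inner w (x - y) \<le> inner g (x - y) + a * inner w g + a * inner (A x - A y) g"
    using A[of x y] mult_nonneg_nonneg[OF less_imp_le[OF a(1)] inner_ge_zero[of g]] by linarith
  also have "\<dots> \<le> norm g * norm (x - y) + a * (norm w * norm g) + a * (norm (A x - A y) * norm g)"
    using a by (intro add_mono mult_left_mono norm_cauchy_schwarz) auto
  also have "\<dots> \<le> \<rho> * (a * s) + a * (s * \<rho> * \<rho>) + a * (L * (1 + a * s) * \<rho>)"
    using L(2)[of x y] a rho(2,3) unfolding g nxy s(2)
    by (intro add_mono mult_left_mono mult_right_mono order_refl) auto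
  also have "inner w (x - y) = a * \<rho> * (s * s)"
    using rho(2,3) by (simp add: xy dot_square_norm s power2_eq_square)
  finally have "a * \<rho> * (s * s) \<le> a * \<rho> * (s + s * \<rho> + L * (1 + a * s))"
    by (simp add: algebra_simps)
  then have "s * s \<le> s + s * \<rho> + L * (1 + a * s)"
    using a rho(2,3) by simp
  also have "\<dots> \<le> s + s * 1 + L * (1 + a1 * s)"
    using s rho(2,3) L(1) a by (intro add_mono mult_left_mono mult_right_mono order_refl) auto
  finally have quad: "s * s \<le> (2 + a1 * L) * s + L" by (simp add: algebra_simps)
  \<comment> \<open>\<open>C\<close> exceeds the linear coefficient of the quadratic inequality by
    \<open>1 + L\<close>; once \<open>s \<ge> 1\<close>, the part \<open>L * s\<close> covers the
    constant term \<open>L\<close>.\<close>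
  have "s \<le> C"
  proof (rule ccontr)
    assume "\<not> s \<le> C"
    then have sC: "s > C" by simp
    have "a1 * L \<ge> 0" using a L by simp
    then have "s \<ge> 1" using sC L(1) by (simp add: C)
    then have "L \<le> L * s" using L(1) by simp
    moreover have "C * s < s * s" using sC \<open>s \<ge> 1\<close> by simp
    moreover have "C * s = (2 + a1 * L) * s + L * s + s" by (simp add: C algebra_simps)
    ultimately show False using quad s(1) by linarith
  qed
  then have "norm w \<le> C * \<rho>" "norm (x - y) \<le> C * a"
    using s(2) nxy a rho(2,3) by (auto simp: mult.commute[of a])
  then show ?thesis using that yw(1) by blast
qed

text \<open>Against a fixed graph point \<open>(y0, v)\<close>, monotonicity bounds
  \<open>inner (x (r n)) v\<close> by \<open>inner y0 v\<close> up to \<open>e * K\<close>. This is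
  linear in the iterate, so it survives the weak limit; then \<open>e\<close> tends to zero and
  maximality applies.\<close>

lemma weak_limit_zero:
  fixes x :: "nat \<Rightarrow> 'a::real_inner" and r :: "nat \<Rightarrow> nat"
  assumes M: "maximal_monotone M"
    and weak: "strict_mono r" "\<And>y. (\<lambda>n. inner (x (r n)) y) \<longlonglongrightarrow> inner p y"
    and bounded: "\<And>n. norm (x n) \<le> R"
    and near: "\<And>e. 0 < e \<Longrightarrow> \<exists>N. \<forall>k\<ge>N. \<exists>y w. w \<in> M y \<and> norm w \<le> e \<and> norm (x k - y) \<le> e"
  shows "0 \<in> M p"
proof (rule maximal_monotoneI_mem[OF M])
  fix y0 v assume v: "v \<in> M y0"
  define K where "K = R + norm y0 + 1 + norm v"
  have "0 \<le> inner (0 - v) (p - y0) + e * K" if e: "0 < e" "e \<le> 1" for e :: real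
  proof -
    obtain N where N: "\<forall>k\<ge>N. \<exists>y w. w \<in> M y \<and> norm w \<le> e \<and> norm (x k - y) \<le> e"
      using near[OF e(1)] by blast
    have "inner (x (r n)) v \<le> inner y0 v + e * K" if "n \<ge> N" for n
    proof -
      have "r n \<ge> N" using seq_suble[OF weak(1), of n] that by simp
      then obtain y w where yw: "w \<in> M y" "norm w \<le> e" "norm (x (r n) - y) \<le> e" using N by blast
      have "norm (y - y0) \<le> K - norm v"
        using norm_triangle_ineq4[of y y0] norm_triangle_ineq2[of y "x (r n)"] yw(3) bounded[of "r n"] e
        by (simp add: K_def norm_minus_commute)
      then have "norm w * norm (y - y0) \<le> e * (K - norm v)"
        using yw(2) e by (intro mult_mono) auto
      then have "inner w (y - y0) \<le> e * (K - norm v)" using norm_cauchy_schwarz[of w "y - y0"] by linarith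
      moreover have "0 \<le> inner (w - v) (y - y0)" by (rule maximal_monotoneD[OF M yw(1) v])
      moreover have "inner (x (r n) - y) v \<le> e * norm v"
        using norm_cauchy_schwarz[of "x (r n) - y" v] mult_right_mono[OF yw(3) norm_ge_zero[of v]] by linarith
      ultimately show ?thesis
        by (simp add: inner_diff_left inner_diff_right inner_commute algebra_simps)
    qed
    then have "inner p v \<le> inner y0 v + e * K"
      by (intro LIMSEQ_le_const2[OF weak(2)]) blast
    then show ?thesis by (simp add: inner_diff_left inner_diff_right inner_commute)
  qed
  then show "inner (0 - v) (p - y0) \<ge> 0" by (rule nonneg_of_affine_nonneg)
qed

text \<open>Where \<open>q k \<ge> e\<close>, the constant \<open>P\<close> is at most
  \<open>P / e * q k\<close>; dividing by \<open>q k\<close> bounds \<open>c * q k\<close> by a null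
  sequence, so this happens only finitely often.\<close>

lemma tendsto_zero_of_quadratic_bound:
  fixes q s :: "nat \<Rightarrow> real"
  assumes s: "s \<longlonglongrightarrow> 0" "\<And>k. s k \<ge> 0" and q: "\<And>k. q k \<ge> 0" and pos: "c > 0" "P \<ge> 0"
    and le: "\<And>k. c * (q k)\<^sup>2 \<le> s k * (P + Q * q k)"
  shows "q \<longlonglongrightarrow> 0"
proof (rule LIMSEQ_I)
  fix e :: real assume e: "e > 0"
  have "(\<lambda>k. s k * (P / e + Q)) \<longlonglongrightarrow> 0 * (P / e + Q)" by (intro tendsto_intros s)
  then have "eventually (\<lambda>k. s k * (P / e + Q) < c * e) sequentially"
    using e pos by (intro order_tendstoD) auto
  then obtain N where N: "\<And>k. k \<ge> N \<Longrightarrow> s k * (P / e + Q) < c * e"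
    by (auto simp: eventually_sequentially)
  have "norm (q k - 0) < e" if "k \<ge> N" for k
  proof (rule ccontr)
    assume "\<not> norm (q k - 0) < e"
    then have qe: "q k \<ge> e" using q[of k] by simp
    have "P \<le> P / e * q k" using mult_left_mono[OF qe, of "P / e"] pos e by simp
    then have "s k * (P + Q * q k) \<le> s k * (P / e * q k + Q * q k)"
      using s(2) by (intro mult_left_mono) auto
    then have "(c * q k) * q k \<le> (s k * (P / e + Q)) * q k"
      using le[of k] by (simp add: power2_eq_square algebra_simps)
    then have "c * q k \<le> s k * (P / e + Q)" using qe e by simp
    moreover have "c * e \<le> c * q k" using qe pos by simp
    ultimately show False using N[OF that] by linarith
  qed
  then show "\<exists>N. \<forall>k\<ge>N. norm (q k - 0) < e" by blast
qed

theorem theorem4p8: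
  fixes A1 A2 :: "'a::{real_inner,complete_space} \<Rightarrow> 'a"
    and B :: "'a \<Rightarrow> 'a set"
    and \<beta> \<theta> \<delta> \<delta>bar \<alpha>m1 :: real
    and x :: "nat \<Rightarrow> 'a" and \<alpha> :: "nat \<Rightarrow> real"
  assumes beta_pos: "\<beta> > 0"
    and A1_coco: "cocoercive \<beta> A1"
    and A2_mono: "maximal_monotone (\<lambda>z. {A2 z})"
    and A2_uc: "uniformly_continuous_on UNIV A2"
    and B_mono: "maximal_monotone B"
    and zer_ne: "zer_sum (\<lambda>z. A1 z + A2 z) B \<noteq> {}"
    and theta: "0 < \<theta>" "\<theta> < 1"
    and delta: "0 < \<delta>" "\<delta> < 1"
    and deltabar: "\<delta>bar > 0" "1 - \<delta> - \<delta>bar > 0"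
    and alpham1: "\<alpha>m1 > 0" "\<alpha>m1 \<le> 4 * \<beta> * \<delta>bar"
    and alpha_def: "\<And>k. \<alpha> k = (let \<alpha>p = (if k = 0 then \<alpha>m1 else \<alpha> (k - 1))
                         in \<alpha>p * \<theta> ^ linesearch_j A1 A2 B \<theta> \<delta> \<alpha>p (x k))"
    and x_step: "\<And>k. x (Suc k) = proj (T_set A2 \<delta>bar (\<alpha> k) (x k)
                         (fb_point (\<lambda>z. A1 z + A2 z) B (\<alpha> k) (x k))) (x k)"
    and no_stop: "\<And>k. x (Suc k) \<noteq> x k"
  shows "\<forall>p. weak_accumulation_point x p \<longrightarrow> p \<in> zer_sum (\<lambda>z. A1 z + A2 z) B"
proof -

  \<comment> \<open>Maximal monotonicity of the sum\<close>
  define A where "A = (\<lambda>z. A1 z + A2 z)"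
  define M where "M = (\<lambda>z. (\<lambda>b. A z + b) ` B z)"
  define c where "c = 1 - \<delta> - \<delta>bar"
  have c: "c > 0" using deltabar by (simp add: c_def)
  have A2m: "inner (A2 u - A2 v) (u - v) \<ge> 0" for u v
    using maximal_monotoneD[OF A2_mono, of "A2 u" u "A2 v" v] by simp
  have A1m: "inner (A1 u - A1 v) (u - v) \<ge> 0" for u v
  proof -
    have "0 \<le> \<beta> * (norm (A1 u - A1 v))\<^sup>2" using beta_pos by simp
    then show ?thesis using A1_coco unfolding cocoercive_def by (meson order_trans)
  qed
  have Am: "inner (A u - A v) (u - v) \<ge> 0" for u v
    using A1m[of u v] A2m[of u v] by (simp add: A_def inner_add_left inner_diff_left)
  have A_uc: "uniformly_continuous_on UNIV A"
    unfolding A_def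
    by (intro uniformly_continuous_on_add A2_uc cocoercive_uniformly_continuous[OF A1_coco beta_pos])
  have M: "maximal_monotone M"
    unfolding M_def by (rule maximal_monotone_sum[OF B_mono Am A_uc])
  have zer: "zer_sum (\<lambda>z. A1 z + A2 z) B = {z. 0 \<in> M z}"
    by (simp add: zer_sum_def M_def A_def)

  \<comment> \<open>Line search and step sizes\<close>
  define tst where "tst = (\<lambda>z a. a * inner (A2 z - A2 (fb_point A B a z)) (z - fb_point A B a z)
      \<le> \<delta> * (norm (z - fb_point A B a z))\<^sup>2)"
  define J where "J = linesearch_j A1 A2 B \<theta> \<delta>"
  have J: "J s z = (LEAST j. tst z (s * \<theta> ^ j))" for s z
    by (simp add: J_def linesearch_j_def tst_def Let_def A_def)
  have J_ok: "tst z (s * \<theta> ^ J s z)" if "s > 0" for s z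
    unfolding J
    by (rule LeastI_ex)
       (use linesearch_terminates[OF B_mono A2_uc that theta delta(1), of z A] in \<open>simp add: tst_def\<close>)
  \<comment> \<open>Dividing the accepted step by \<open>\<theta>\<close> recovers the last rejected
    trial step.\<close>
  have J_min: "\<not> tst z (s * \<theta> ^ J s z / \<theta>)" if "0 < J s z" for s z
  proof -
    have "\<not> tst z (s * \<theta> ^ (J s z - 1))"
      using that not_less_Least[of "J s z - 1" "\<lambda>j. tst z (s * \<theta> ^ j)"] unfolding J[symmetric] by simp
    moreover have "s * \<theta> ^ J s z / \<theta> = s * \<theta> ^ (J s z - 1)"
      using that theta by (cases "J s z") auto
    ultimately show ?thesis by simp
  qed
  define prev where "prev = (\<lambda>k. if k = 0 then \<alpha>m1 else \<alpha> (k - 1))"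
  have alpha: "\<alpha> k = prev k * \<theta> ^ J (prev k) (x k)" for k
    using alpha_def[of k] by (simp add: prev_def J_def Let_def)
  have apos: "\<alpha> k > 0" for k
    by (induction k) (use alpham1 theta in \<open>simp_all add: alpha[of 0] alpha[of "Suc _"] prev_def\<close>)
  have ppos: "prev k > 0" for k using apos alpham1 by (simp add: prev_def)
  have a_le_prev: "\<alpha> k \<le> prev k" for k
    using ppos[of k] theta by (simp add: alpha[of k] mult_le_cancel_left1 power_le_one)
  have dec: "decseq \<alpha>"
    by (rule decseq_SucI) (use a_le_prev[of "Suc _"] in \<open>simp add: prev_def\<close>)
  have a_le: "\<alpha> k \<le> \<alpha>m1" for k
    using decseqD[OF dec, of 0 k] a_le_prev[of 0] by (simp add: prev_def)
  have tst_ok: "tst (x k) (\<alpha> k)" for k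
    using J_ok[OF ppos, of "x k" k] by (simp add: alpha[symmetric])
  have backtracked: "\<not> tst (x k) (\<alpha> k / \<theta>)" if "\<alpha> k < prev k" for k
  proof -
    have "J (prev k) (x k) > 0" using that alpha[of k] by (cases "J (prev k) (x k)") auto
    then show ?thesis using J_min alpha[of k] by simp
  qed

  \<comment> \<open>Forward-backward points and projection multipliers\<close>
  define xb where "xb = (\<lambda>k. fb_point A B (\<alpha> k) (x k))"
  define q where "q = (\<lambda>k. norm (x k - xb k))"
  define \<rho> where "\<rho> = (\<lambda>k. q k / \<alpha> k)"
  have mem: "(1 / \<alpha> k) *\<^sub>R (x k - xb k) - A (x k) \<in> B (xb k)" for k
    unfolding xb_def by (rule fb_point_mem[OF B_mono apos])
  have step: "x (Suc k) = proj (T_set A2 \<delta>bar (\<alpha> k) (x k) (xb k)) (x k)" for k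
    using x_step[of k] by (simp add: xb_def A_def)
  \<comment> \<open>Otherwise \<open>x k\<close> would lie in its own halfspace, the projection
    would fix it, and the method would stop.\<close>
  have neq: "x k \<noteq> xb k" for k
  proof
    assume "x k = xb k"
    then have "x k \<in> T_set A2 \<delta>bar (\<alpha> k) (x k) (xb k)" by (simp add: T_set_def)
    then show False using proj_mem step no_stop by metis
  qed
  have qpos: "q k > 0" for k using neq by (simp add: q_def)
  have rpos: "\<rho> k > 0" for k using qpos apos by (simp add: \<rho>_def)
  have a4: "\<alpha> k \<le> 4 * \<beta> * \<delta>bar" for k using a_le[of k] alpham1 by linarith
  have "\<exists>l>0. c * l * (q k)\<^sup>2 / \<alpha> k \<le> (norm (x (Suc k) - x k))\<^sup>2 \<and>
      (\<forall>y. \<forall>w\<in>M y. (norm (x (Suc k) - y))\<^sup>2 \<le>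
          (norm (x k - y))\<^sup>2 - 2 * l * inner w (xb k - y) - (norm (x (Suc k) - x k))\<^sup>2) \<and>
      c * (q k)\<^sup>2 \<le> norm (x (Suc k) - x k) * (q k + \<alpha> k * norm (A2 (x k) - A2 (xb k)))" for k
  proof -
    have mem': "(1 / \<alpha> k) *\<^sub>R (x k - xb k) - (A1 (x k) + A2 (x k)) \<in> B (xb k)"
      using mem[of k] by (simp add: A_def)
    have test: "\<alpha> k * inner (A2 (x k) - A2 (xb k)) (x k - xb k) \<le> \<delta> * (norm (x k - xb k))\<^sup>2"
      using tst_ok[of k] by (simp add: tst_def xb_def)
    show ?thesis
      by (rule projection_step[OF A1_coco A2m B_mono beta_pos apos a4 mem' test c_def c neq step])
         (auto simp: M_def A_def q_def)
  qed
  then obtain l where l: "\<And>k. l k > 0"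
      "\<And>k. c * l k * (q k)\<^sup>2 / \<alpha> k \<le> (norm (x (Suc k) - x k))\<^sup>2"
      "\<And>k y w. w \<in> M y \<Longrightarrow> (norm (x (Suc k) - y))\<^sup>2 \<le>
          (norm (x k - y))\<^sup>2 - 2 * l k * inner w (xb k - y) - (norm (x (Suc k) - x k))\<^sup>2"
      "\<And>k. c * (q k)\<^sup>2 \<le> norm (x (Suc k) - x k) * (q k + \<alpha> k * norm (A2 (x k) - A2 (xb k)))"
    by metis

  \<comment> \<open>Fejer monotonicity\<close>
  obtain z where z: "0 \<in> M z" using zer_ne zer by auto
  define E where "E = (\<lambda>k. (norm (x k - z))\<^sup>2)"
  \<comment> \<open>The case \<open>w = 0\<close> of the projection inequality. The telescoping
    differences of \<open>E\<close> are the budget for all later error terms.\<close>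
  have fejer: "(norm (x (Suc k) - x k))\<^sup>2 \<le> E k - E (Suc k)" for k
    using l(3)[OF z, of k] by (simp add: E_def)
  have "E (Suc k) \<le> E k" for k
    using fejer[of k] zero_le_power2[of "norm (x (Suc k) - x k)"] by linarith
  then have "decseq E" by (rule decseq_SucI)
  moreover have "E k \<ge> 0" for k by (simp add: E_def)
  ultimately obtain El where El: "E \<longlonglongrightarrow> El" "\<And>k. El \<le> E k"
    using decseq_convergent[of E 0] by blast
  have bounded: "norm (x k) \<le> sqrt (E 0) + norm z" for k
  proof -
    have "norm (x k - z) \<le> sqrt (E 0)"
      using decseqD[OF \<open>decseq E\<close>, of 0 k] by (intro real_le_rsqrt) (simp add: E_def)
    then show ?thesis using norm_triangle_ineq2[of "x k" z] by linarith
  qed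

  \<comment> \<open>Small graph elements near late iterates\<close>
  have near: "\<exists>N. \<forall>k\<ge>N. \<exists>y w. w \<in> M y \<and> norm w \<le> e \<and> norm (x k - y) \<le> e" if e: "0 < e" for e :: real
  proof -
    obtain al where al: "\<alpha> \<longlonglongrightarrow> al" "\<And>k. al \<le> \<alpha> k"
      using decseq_convergent[OF dec, of 0] apos less_imp_le by blast
    have "al \<ge> 0" using al(1) apos by (intro LIMSEQ_le_const) (auto intro: less_imp_le)
    then consider "al > 0" | "al = 0" by linarith
    then show ?thesis
    proof cases

      \<comment> \<open>Step sizes bounded away from zero\<close>
      case 1
      obtain L where L: "L > 0" "\<And>u v. norm (A2 u - A2 v) \<le> L * (1 + norm (u - v))"
        using uniformly_continuous_affine_growth[OF A2_uc] by blast
      have "(\<lambda>k. E k - E (Suc k)) \<longlonglongrightarrow> El - El"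
        by (intro tendsto_intros El LIMSEQ_Suc)
      then have "(\<lambda>k. sqrt (E k - E (Suc k))) \<longlonglongrightarrow> 0"
        using tendsto_real_sqrt by fastforce
      then have s0: "(\<lambda>k. norm (x (Suc k) - x k)) \<longlonglongrightarrow> 0"
        by (rule Lim_null_comparison[rotated]) (use fejer real_le_rsqrt in auto)
      have q0: "q \<longlonglongrightarrow> 0"
      proof (rule tendsto_zero_of_quadratic_bound[OF s0 _ _ c])
        fix k
        have "\<alpha> k * norm (A2 (x k) - A2 (xb k)) \<le> \<alpha>m1 * (L * (1 + q k))"
          using L(2)[of "x k" "xb k"] a_le[of k] alpham1 by (intro mult_mono) (auto simp: q_def)
        then have "q k + \<alpha> k * norm (A2 (x k) - A2 (xb k)) \<le> \<alpha>m1 * L + (1 + \<alpha>m1 * L) * q k"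
          by (simp add: algebra_simps)
        from mult_left_mono[OF this norm_ge_zero]
        show "c * (q k)\<^sup>2 \<le> norm (x (Suc k) - x k) * (\<alpha>m1 * L + (1 + \<alpha>m1 * L) * q k)"
          using l(4)[of k] by (rule order_trans[rotated])
      qed (use alpham1 L in \<open>auto simp: q_def\<close>)
      obtain d where d: "d > 0" "\<And>u v. norm (u - v) < d \<Longrightarrow> norm (A u - A v) < e / 2"
        using A_uc[unfolded uniformly_continuous_on_def, rule_format, of "e / 2"] e
        by (auto simp: dist_norm)
      \<comment> \<open>The three bounds give, in turn, distance below \<open>e\<close>, a
        difference of \<open>A\<close> below \<open>e / 2\<close>, and a scaled residual of at most
        \<open>e / 2\<close>, since \<open>\<alpha> k \<ge> al\<close>.\<close>
      define h where "h = min (min e d) (al * e / 2)"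
      have "h > 0" using e d 1 by (simp add: h_def)
      then have "eventually (\<lambda>k. q k < h) sequentially" by (rule order_tendstoD(2)[OF q0])
      then obtain N where N: "\<And>k. k \<ge> N \<Longrightarrow> q k < h" by (auto simp: eventually_sequentially)
      show ?thesis
      proof (intro exI[of _ N] allI impI)
        fix k assume "k \<ge> N"
        then have qh: "q k < e" "q k < d" "q k < al * e / 2" using N[of k] by (auto simp: h_def)
        define w where "w = (1 / \<alpha> k) *\<^sub>R (x k - xb k) - (A (x k) - A (xb k))"
        have "w = A (xb k) + ((1 / \<alpha> k) *\<^sub>R (x k - xb k) - A (x k))" by (simp add: w_def)
        then have "w \<in> M (xb k)" using mem[of k] by (auto simp: M_def)
        moreover have "norm w \<le> e"
        proof -
          have "norm ((1 / \<alpha> k) *\<^sub>R (x k - xb k)) = q k / \<alpha> k" using apos[of k] by (simp add: q_def)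
          also have "\<dots> \<le> q k / al" using 1 al(2)[of k] qpos[of k] by (intro divide_left_mono) auto
          also have "\<dots> \<le> e / 2" using qh(3) 1 by (simp add: field_simps)
          finally have "norm ((1 / \<alpha> k) *\<^sub>R (x k - xb k)) \<le> e / 2" .
          moreover have "norm (A (x k) - A (xb k)) < e / 2" using qh(2) d(2) by (simp add: q_def)
          ultimately show ?thesis
            unfolding w_def using norm_triangle_ineq4[of "(1 / \<alpha> k) *\<^sub>R (x k - xb k)" "A (x k) - A (xb k)"]
            by linarith
        qed
        ultimately show "\<exists>y w. w \<in> M y \<and> norm w \<le> e \<and> norm (x k - y) \<le> e"
          using qh(1) by (intro exI[of _ "xb k"] exI[of _ w]) (auto simp: q_def)
      qed
    next

      \<comment> \<open>Step sizes tending to zero\<close>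
      case 2
      \<comment> \<open>A positive sequence with limit zero cannot become constant, so backtracking
        recurs beyond every index. There the trial step \<open>\<alpha> k / \<theta>\<close> was
        rejected, and its residual is small.\<close>
      have liminf: "\<exists>k\<ge>K. \<rho> k \<le> f" if f: "0 < f" for f K
      proof -
        \<comment> \<open>The factor \<open>\<theta>\<close> compensates for estimating at
          \<open>\<alpha> k / \<theta>\<close> instead of \<open>\<alpha> k\<close>.\<close>
        have "0 < 1 / \<delta>" "0 < f * \<theta>" using delta f theta by auto
        then obtain h where h: "h > 0"
          "\<And>a u v. 0 < a \<Longrightarrow> a \<le> h \<Longrightarrow> norm (u - v) \<le> a * (1 / \<delta>) * norm (A2 u - A2 v) \<Longrightarrow> norm (u - v) \<le> f * \<theta> * a"
          using small_residual[OF A2_uc] by metis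
        have "eventually (\<lambda>k. \<alpha> k < h * \<theta>) sequentially"
          using al(1) h(1) theta 2 by (intro order_tendstoD) auto
        then obtain N where N: "\<And>k. k \<ge> N \<Longrightarrow> \<alpha> k < h * \<theta>" by (auto simp: eventually_sequentially)
        define K' where "K' = max N K"
        have "\<exists>k>K'. \<alpha> k < prev k"
        proof (rule ccontr)
          assume "\<not> ?thesis"
          then have eq: "\<alpha> k = prev k" if "k > K'" for k using a_le_prev[of k] that by fastforce
          have "\<alpha> (K' + n) = \<alpha> K'" for n
            by (induction n) (use eq[of "Suc (K' + _)"] in \<open>simp_all add: prev_def\<close>)
          then have "(\<lambda>n. \<alpha> (n + K')) \<longlonglongrightarrow> \<alpha> K'" by (simp add: add.commute)
          then have "\<alpha> K' = 0"
            using LIMSEQ_ignore_initial_segment[OF al(1), of K'] 2 LIMSEQ_unique by blast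
          then show False using apos[of K'] by simp
        qed
        then obtain k where k: "k > K'" "\<alpha> k < prev k" by blast
        define a where "a = \<alpha> k / \<theta>"
        have a: "a > 0" "a \<le> h" "\<alpha> k \<le> a"
          using apos[of k] theta N[of k] k(1) by (auto simp: a_def K'_def field_simps)
        have "norm (x k - fb_point A B a (x k)) \<le> f * \<theta> * a"
          using backtracked[OF k(2)] linesearch_failure_bound[OF _ a(1) delta(1), of A2 "x k" "fb_point A B a (x k)"]
          by (intro h(2) a) (simp add: tst_def a_def)
        moreover have "q k \<le> norm (x k - fb_point A B a (x k))"
          unfolding q_def xb_def by (rule fb_point_displacement_mono[OF B_mono apos a(3)])
        moreover have "f * \<theta> * a = f * \<alpha> k" using theta by (simp add: a_def)
        ultimately have "\<rho> k \<le> f" using apos[of k] by (simp add: \<rho>_def divide_le_eq)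
        then show ?thesis using k(1) by (intro exI[of _ k]) (auto simp: K'_def)
      qed
      obtain L where L: "L > 0" "\<And>u v. norm (A u - A v) \<le> L * (1 + norm (u - v))"
        using uniformly_continuous_affine_growth[OF A_uc] by blast
      define C where "C = 3 + \<alpha>m1 * L + L"
      have C: "C > 0" using alpham1 L by (simp add: C_def add_pos_pos)
      \<comment> \<open>The potential \<open>(norm (x k - y))\<^sup>2 + 2 * C / c * E k\<close> does
        not increase along the backward iteration: the decrease of \<open>E\<close> pays for the
        growth of the distance.\<close>
      have shadow: "\<exists>y w. w \<in> M y \<and> norm w \<le> C * \<rho> m \<and>
          (norm (x k - y))\<^sup>2 + 2 * C / c * E k \<le> (C * \<alpha> m)\<^sup>2 + 2 * C / c * E m"
        if "m \<le> k" "\<And>j. m \<le> j \<Longrightarrow> j < k \<Longrightarrow> \<rho> m \<le> \<rho> j" "\<rho> m \<le> 1" for m k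
        using that
      proof (induction k rule: dec_induct)
        case base
        obtain y w where "w \<in> (\<lambda>b. A y + b) ` B y" "norm w \<le> C * \<rho> m" "norm (x m - y) \<le> C * \<alpha> m"
          by (rule nearby_small_graph_element[OF B_mono Am M[unfolded M_def] L apos a_le mem _ rpos base(2) C_def])
             (simp add: \<rho>_def q_def)
        moreover from this have "(norm (x m - y))\<^sup>2 \<le> (C * \<alpha> m)\<^sup>2" by (intro power_mono) auto
        ultimately show ?case by (intro exI[of _ y] exI[of _ w]) (auto simp: M_def)
      next
        case (step k)
        then obtain y w where yw: "w \<in> M y" "norm w \<le> C * \<rho> m"
          "(norm (x k - y))\<^sup>2 + 2 * C / c * E k \<le> (C * \<alpha> m)\<^sup>2 + 2 * C / c * E m" by fastforce
        obtain y' w' where yw': "w' \<in> M y'" "y = y' + l k *\<^sub>R w'" "norm w' \<le> norm w"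
          using backward_step[OF M l(1) yw(1)] by blast
        \<comment> \<open>Minimality of \<open>\<rho> m\<close> enters here: it makes
          \<open>norm w'\<close> at most \<open>C * \<rho> k\<close>, so the error of this step has
          the order \<open>l k * (q k)\<^sup>2 / \<alpha> k\<close>, which the squared step
          controls.\<close>
        have "\<rho> m \<le> \<rho> k" using step by simp
        then have w'C: "norm w' \<le> C * (q k / \<alpha> k)"
          using yw(2) yw'(3) C by (smt (verit) \<rho>_def mult_left_mono)
        \<comment> \<open>The backward step contributes \<open>inner w' (x k - y')\<close> and the
          projection inequality \<open>- inner w' (xb k - y')\<close>, both with factor
          \<open>2 * l k\<close>, so \<open>y'\<close> cancels and only the displacement
          \<open>x k - xb k\<close> remains.\<close>
        have "(norm (x k - y))\<^sup>2 = (norm (x k - y'))\<^sup>2 - 2 * l k * inner w' (x k - y') + (l k)\<^sup>2 * (norm w')\<^sup>2"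
          unfolding yw'(2) power2_norm_eq_inner
          by (simp add: inner_diff_left inner_diff_right inner_add_left inner_add_right inner_commute power2_eq_square algebra_simps)
        moreover have "(l k)\<^sup>2 * (norm w')\<^sup>2 \<ge> 0" by simp
        ultimately have "(norm (x (Suc k) - y'))\<^sup>2 \<le> (norm (x k - y))\<^sup>2
            + 2 * l k * inner w' (x k - y') - 2 * l k * inner w' (xb k - y')"
          using l(3)[OF yw'(1), of k] zero_le_power2[of "norm (x (Suc k) - x k)"] by linarith
        also have "\<dots> = (norm (x k - y))\<^sup>2 + 2 * l k * inner w' (x k - xb k)"
          by (simp add: inner_diff_right algebra_simps)
        also have "\<dots> \<le> (norm (x k - y))\<^sup>2 + 2 * l k * (C * (q k / \<alpha> k) * q k)"
          using l(1)[of k] w'C norm_cauchy_schwarz[of w' "x k - xb k"] mult_right_mono[OF w'C, of "q k"] qpos[of k]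
          by (intro add_left_mono mult_left_mono) (auto simp: q_def)
        also have "2 * l k * (C * (q k / \<alpha> k) * q k) = 2 * C / c * (c * l k * (q k)\<^sup>2 / \<alpha> k)"
          using c by (simp add: power2_eq_square)
        also have "(norm (x k - y))\<^sup>2 + 2 * C / c * (c * l k * (q k)\<^sup>2 / \<alpha> k)
            \<le> (norm (x k - y))\<^sup>2 + 2 * C / c * (E k - E (Suc k))"
          using l(2)[of k] fejer[of k] C c by (intro add_left_mono mult_left_mono) auto
        finally have "(norm (x (Suc k) - y'))\<^sup>2 + 2 * C / c * E (Suc k) \<le> (norm (x k - y))\<^sup>2 + 2 * C / c * E k"
          by (simp add: right_diff_distrib)
        then show ?case
          using yw(2,3) yw'(1,3) by (intro exI[of _ y'] exI[of _ w']) auto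
      qed
      have "(\<lambda>k. (C * \<alpha> k)\<^sup>2 + 2 * C / c * (E k - El)) \<longlonglongrightarrow> (C * 0)\<^sup>2 + 2 * C / c * (El - El)"
        using al(1) 2 by (intro tendsto_intros El) auto
      then have "eventually (\<lambda>k. (C * \<alpha> k)\<^sup>2 + 2 * C / c * (E k - El) < e\<^sup>2) sequentially"
        using e by (intro order_tendstoD) auto
      then obtain K where K: "\<And>k. k \<ge> K \<Longrightarrow> (C * \<alpha> k)\<^sup>2 + 2 * C / c * (E k - El) < e\<^sup>2"
        by (auto simp: eventually_sequentially)
      \<comment> \<open>The bound 1 is required to start the backward iteration, and
        \<open>e / C\<close> yields \<open>norm w \<le> e\<close>.\<close>
      have "0 < min 1 (e / C)" using e C by simp
      from liminf[OF this] obtain N where N: "N \<ge> K" "\<rho> N \<le> min 1 (e / C)" by blast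
      show ?thesis
      proof (intro exI[of _ N] allI impI)
        fix k assume k: "k \<ge> N"
        \<comment> \<open>The segment contains \<open>N\<close>, so the minimum of
          \<open>\<rho>\<close> inherits the bound on \<open>\<rho> N\<close>; it starts at
          \<open>K\<close>, so the initial distance and the remaining decrease of \<open>E\<close>
          after \<open>m\<close> are small.\<close>
        have "finite {K..k}" "{K..k} \<noteq> {}" using k N by auto
        then obtain m where "is_arg_min \<rho> (\<lambda>j. j \<in> {K..k}) m"
          using ex_is_arg_min_if_finite by blast
        then have m: "K \<le> m" "m \<le> k" "\<And>j. K \<le> j \<Longrightarrow> j \<le> k \<Longrightarrow> \<rho> m \<le> \<rho> j"
          by (auto simp: is_arg_min_linorder)
        have rm: "\<rho> m \<le> 1" "\<rho> m \<le> e / C" using m(3)[of N] N k by auto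
        have "\<rho> m \<le> \<rho> j" if "m \<le> j" "j < k" for j using that m by simp
        from shadow[OF m(2) this rm(1)] obtain y w where yw: "w \<in> M y" "norm w \<le> C * \<rho> m"
          "(norm (x k - y))\<^sup>2 + 2 * C / c * E k \<le> (C * \<alpha> m)\<^sup>2 + 2 * C / c * E m"
          by blast
        have "2 * C / c * El \<le> 2 * C / c * E k" using El(2)[of k] C c by (intro mult_left_mono) auto
        then have "(norm (x k - y))\<^sup>2 \<le> e\<^sup>2" using yw(3) K[OF m(1)] by (simp add: right_diff_distrib)
        then have "norm (x k - y) \<le> e" by (rule power2_le_imp_le) (use e in simp)
        moreover have "norm w \<le> e" using yw(2) rm(2) C by (simp add: field_simps)
        ultimately show "\<exists>y w. w \<in> M y \<and> norm w \<le> e \<and> norm (x k - y) \<le> e" using yw(1) by blast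
      qed
    qed
  qed

  \<comment> \<open>Passage to weak accumulation points\<close>
  show ?thesis
  proof (intro allI impI)
    fix p assume "weak_accumulation_point x p"
    then obtain r where "strict_mono r" "\<And>y. (\<lambda>n. inner (x (r n)) y) \<longlonglongrightarrow> inner p y"
      by (auto simp: weak_accumulation_point_def)
    from weak_limit_zero[OF M this bounded near] show "p \<in> zer_sum (\<lambda>z. A1 z + A2 z) B"
      by (simp add: zer)
  qed
qed

end
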